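(* Let $\Lambda$ be a strongly connected finite $k$-graph and $(G,\Lambda)$ a self-similar groupoid action. Then there is a central unitary representation $V$ of the group $\operatorname{Per}(G,\Lambda)$ in $\mathcal O(G,\Lambda)$ given by $$V_{p-q}=\sum_{\lambda\in\Lambda^p}t_\lambda\, u_{h_{p,q}(\lambda)}\,t_{\theta_{p,q}(\lambda)}^*\qquad (p,q\in\mathbb N^k,\ p-q\in\operatorname{Per}(G,\Lambda)).$$
   Context: Conventions: $\mathbb N=\{0,1,2,\dots\}$ and $e_1,\dots,e_k$ are the standard generators of $\mathbb N^k$ ($k\ge1$). A $k$-graph is a countable small category $\Lambda$ with a degree functor $d:\Lambda\to\mathbb N^k$ such that whenever $d(\lambda)=p+q$ there are unique $\mu,\nu$ with $\lambda=\mu\nu$, $d(\mu)=p$, $d(\nu)=q$. Write $\Lambda^p=d^{-1}(p)$; $\Lambda^0$ is identified with the set of objects (vertices); $r,s:\Lambda\to\Lambda^0$ are the codomain and domain maps, so $\lambda\mu$ is defined iff $s(\lambda)=r(\mu)$. An edge is an element of some $\Lambda^{e_i}$. $v\Lambda=r^{-1}(v)$, $\Lambda v=s^{-1}(v)$, $v\Lambda^p=v\Lambda\cap\Lambda^p$. $\Lambda$ is finite if every $\Lambda^p$ is finite; it is strongly connected if $v\Lambda w=v\Lambda\cap\Lambda w\ne\emptyset$ for all $v,w\in\Lambda^0$; as usual $\Lambda^{e_i}\neq\emptyset$ for each $i$. Self-similar actions: For a groupoid $G$, $\operatorname{dom},\operatorname{cod}$ are the source and range maps, and $gh$ is defined iff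 $\operatorname{dom}(g)=\operatorname{cod}(h)$. A partial isomorphism of $\Lambda$ consists of $v,w\in\Lambda^0$ and a bijection $g:v\Lambda\to w\Lambda$ with $g(v\Lambda^p)=w\Lambda^p$ for all $p$, and $g(\lambda e)\in g(\lambda)\Lambda$ for all $\lambda\in v\Lambda$ and edges $e\in s(\lambda)\Lambda$; put $\operatorname{dom}(g)=v$, $\operatorname{cod}(g)=w$. These form a groupoid $\operatorname{PIso}(\Lambda)$ under composition, with unit space $\Lambda^0$ ($v$ identified with $\mathrm{id}_{v\Lambda}$). An action of a groupoid $G$ with unit space $\Lambda^0$ on $\Lambda$ is a (unit-preserving) groupoid homomorphism $G\to\operatorname{PIso}(\Lambda)$, written $g\cdot\mu$; it is faithful if injective. A self-similar groupoid action $(G,\Lambda)$ is a faithful action such that for every $g\in G$ and edge $e\in\operatorname{dom}(g)\Lambda$ there is $h\in G$ with $g\cdot(e\lambda)=(g\cdot e)(h\cdot\lambda)$ for all $\lambda\in s(e)\Lambda$; this $h$ is unique and written $g|_e$. For $\lambda\in\operatorname{dom}(g)\Lambda$, factored into edges as $\lambda_1\cdots\lambda_l$, put $g|_\lambda=(\cdots(g|_{\lambda_1})|_{\lambda_2}\cdots)|_{\lambda_l}$ (independent of the factorisation; $g|_{\operatorname{dom}(g)}=g$), so $g\cdot(\lambda\mu)=(g\cdot\lambda)(g|_\lambda\cdot\mu)$. Algebra: A unitary representation of $G$ in a $C^*$-algebra is a family of partial isometries $\{U_g\}$ such that the $U_v$ ($v\in G^{(0)}$) are mutually orthogonal projections,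 $U_g^*=U_{g^{-1}}$, and $U_gU_h=U_{gh}$ if $\operatorname{dom}(g)=\operatorname{cod}(h)$, $0$ otherwise. For $\lambda,\mu\in\Lambda$, $\Lambda^{\min}(\lambda,\mu)=\{(\eta,\zeta):\lambda\eta=\mu\zeta,\ d(\lambda\eta)=d(\lambda)\vee d(\mu)\}$. A Toeplitz–Cuntz–Krieger $\Lambda$-family is a set of partial isometries $\{T_\lambda\}$ with $\{T_v:v\in\Lambda^0\}$ mutually orthogonal projections, $T_\lambda T_\mu=T_{\lambda\mu}$ if $s(\lambda)=r(\mu)$, and $T_\lambda^*T_\mu=\sum_{(\eta,\zeta)\in\Lambda^{\min}(\lambda,\mu)}T_\eta T_\zeta^*$; it is a Cuntz–Krieger family if also $T_v=\sum_{\lambda\in v\Lambda^p}T_\lambda T_\lambda^*$ for all $v\in\Lambda^0$, $p\in\mathbb N^k$. The Cuntz–Pimsner algebra $\mathcal O(G,\Lambda)$ is the universal $C^*$-algebra generated by a unitary representation $u$ of $G$ and a Cuntz–Krieger $\Lambda$-family $t$ such that $u_v=t_v$ ($v\in\Lambda^0$), $\sum_vt_v=1$, and $u_gt_\lambda=t_{g\cdot\lambda}u_{g|_\lambda}$ if $\operatorname{dom}(g)=r(\lambda)$, $0$ otherwise. Periodicity: $\Lambda^\infty$ is the set of degree-preserving functors $x:\Omega_k\to\Lambda$, where $\Omega_k=\{(p,q)\in\mathbb N^k\times\mathbb N^k:p\le q\}$ with $(p,q)(q,n)=(p,n)$, $d(p,q)=q-p$; $r(x)=x(0,0)$, $v\Lambda^\infty=\{x:r(x)=v\}$,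 $\sigma^n(x)(p,q)=x(p+n,q+n)$; for $\lambda\in\Lambda$, $y\in s(\lambda)\Lambda^\infty$, $\lambda y$ is the concatenation. $G$ acts on $\Lambda^\infty$ by $(g\cdot x)(p,q)=g|_{x(0,p)}\cdot x(p,q)$ for $x\in\operatorname{dom}(g)\Lambda^\infty$. $\operatorname{Per}(G,\Lambda)$ is the set of $p-q$ ($p,q\in\mathbb N^k$) for which there is $g\in G$ with $\sigma^p(x)=\sigma^q(g\cdot x)$ for all $x\in\operatorname{dom}(g)\Lambda^\infty$; it is a subgroup of $\mathbb Z^k$. For $p,q\in\mathbb N^k$ with $p-q\in\operatorname{Per}(G,\Lambda)$ and $\mu\in\Lambda^p$, $(\theta_{p,q}(\mu),h_{p,q}(\mu))$ denotes the unique pair in $\Lambda^q\times G$ with $\operatorname{cod}(h_{p,q}(\mu))=s(\mu)$, $\operatorname{dom}(h_{p,q}(\mu))=s(\theta_{p,q}(\mu))$ and $\mu(h_{p,q}(\mu)\cdot x)=\theta_{p,q}(\mu)x$ for all $x\in\operatorname{dom}(h_{p,q}(\mu))\Lambda^\infty$. A central unitary representation means a homomorphism $a\mapsto V_a$ of the group into the unitaries of the centre of $\mathcal O(G,\Lambda)$; in particular the formula depends only on $p-q$. *)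

theory Defs
  imports
    Complex_Main
    "HOL-Library.Countable_Set"
    "HOL-Library.FuncSet"
    "HOL-Library.Function_Algebras"
    "HOL-Algebra.Module"
begin

section \<open>Higher-rank graphs\<close>

text \<open>
  Elements of $\mathbb{N}^k$ are functions \<^typ>\<open>'k \<Rightarrow> nat\<close> on a finite index type of cardinality $k$,
  with pointwise sum, order and join.
\<close>

type_synonym 'k degree = "'k \<Rightarrow> nat"

definition std_gen :: "'k \<Rightarrow> 'k degree" where
  "std_gen i = (\<lambda>j. if j = i then 1 else 0)"

definition ddiff :: "'k degree \<Rightarrow> 'k degree \<Rightarrow> 'k \<Rightarrow> int" where
  "ddiff p q = (\<lambda>i. int (p i) - int (q i))"

text \<open>
  Categories are presented by their morphisms: objects are represented by their identity morphisms,
  so codomain and domain maps take values among the morphisms.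
\<close>

record ('k, 'l) kgraph =
  paths :: "'l set"
  rng :: "'l \<Rightarrow> 'l"
  src :: "'l \<Rightarrow> 'l"
  cmp :: "'l \<Rightarrow> 'l \<Rightarrow> 'l" (infixl "\<cdot>\<index>" 70)
  deg :: "'l \<Rightarrow> 'k degree"

definition small_category :: "('k, 'l) kgraph \<Rightarrow> bool" where
  "small_category \<Lambda> \<longleftrightarrow>
    (\<forall>\<mu>\<in>paths \<Lambda>. rng \<Lambda> \<mu> \<in> paths \<Lambda> \<and> src \<Lambda> \<mu> \<in> paths \<Lambda>
        \<and> rng \<Lambda> (rng \<Lambda> \<mu>) = rng \<Lambda> \<mu> \<and> src \<Lambda> (rng \<Lambda> \<mu>) = rng \<Lambda> \<mu>
        \<and> rng \<Lambda> (src \<Lambda> \<mu>) = src \<Lambda> \<mu> \<and> src \<Lambda> (src \<Lambda> \<mu>) = src \<Lambda> \<mu>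
        \<and> rng \<Lambda> \<mu> \<cdot>\<^bsub>\<Lambda>\<^esub> \<mu> = \<mu> \<and> \<mu> \<cdot>\<^bsub>\<Lambda>\<^esub> src \<Lambda> \<mu> = \<mu>) \<and>
    (\<forall>\<mu>\<in>paths \<Lambda>. \<forall>\<nu>\<in>paths \<Lambda>. src \<Lambda> \<mu> = rng \<Lambda> \<nu> \<longrightarrow>
        \<mu> \<cdot>\<^bsub>\<Lambda>\<^esub> \<nu> \<in> paths \<Lambda> \<and> rng \<Lambda> (\<mu> \<cdot>\<^bsub>\<Lambda>\<^esub> \<nu>) = rng \<Lambda> \<mu> \<and> src \<Lambda> (\<mu> \<cdot>\<^bsub>\<Lambda>\<^esub> \<nu>) = src \<Lambda> \<nu>) \<and>
    (\<forall>\<mu>\<in>paths \<Lambda>. \<forall>\<nu>\<in>paths \<Lambda>. \<forall>\<rho>\<in>paths \<Lambda>. src \<Lambda> \<mu> = rng \<Lambda> \<nu> \<and> src \<Lambda> \<nu> = rng \<Lambda> \<rho> \<longrightarrow>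
        (\<mu> \<cdot>\<^bsub>\<Lambda>\<^esub> \<nu>) \<cdot>\<^bsub>\<Lambda>\<^esub> \<rho> = \<mu> \<cdot>\<^bsub>\<Lambda>\<^esub> (\<nu> \<cdot>\<^bsub>\<Lambda>\<^esub> \<rho>))"

definition k_graph :: "('k::finite, 'l) kgraph \<Rightarrow> bool" where
  "k_graph \<Lambda> \<longleftrightarrow>
    small_category \<Lambda> \<and> countable (paths \<Lambda>) \<and>
    (\<forall>\<mu>\<in>paths \<Lambda>. deg \<Lambda> (rng \<Lambda> \<mu>) = 0 \<and> deg \<Lambda> (src \<Lambda> \<mu>) = 0) \<and>
    (\<forall>\<mu>\<in>paths \<Lambda>. \<forall>\<nu>\<in>paths \<Lambda>. src \<Lambda> \<mu> = rng \<Lambda> \<nu> \<longrightarrow> deg \<Lambda> (\<mu> \<cdot>\<^bsub>\<Lambda>\<^esub> \<nu>) = deg \<Lambda> \<mu> + deg \<Lambda> \<nu>) \<and>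
    (\<forall>\<rho>\<in>paths \<Lambda>. \<forall>p q. deg \<Lambda> \<rho> = p + q \<longrightarrow>
        (\<exists>!(\<mu>\<nu> :: 'l \<times> 'l). case \<mu>\<nu> of (\<mu>, \<nu>) \<Rightarrow>
            \<mu> \<in> paths \<Lambda> \<and> \<nu> \<in> paths \<Lambda> \<and> src \<Lambda> \<mu> = rng \<Lambda> \<nu> \<and> \<rho> = \<mu> \<cdot>\<^bsub>\<Lambda>\<^esub> \<nu> \<and> deg \<Lambda> \<mu> = p \<and> deg \<Lambda> \<nu> = q))"

definition paths_deg :: "('k, 'l) kgraph \<Rightarrow> 'k degree \<Rightarrow> 'l set" where
  "paths_deg \<Lambda> p = {\<mu> \<in> paths \<Lambda>. deg \<Lambda> \<mu> = p}"

definition vertices :: "('k, 'l) kgraph \<Rightarrow> 'l set" where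
  "vertices \<Lambda> = paths_deg \<Lambda> 0"

definition edges :: "('k, 'l) kgraph \<Rightarrow> 'l set" where
  "edges \<Lambda> = (\<Union>i. paths_deg \<Lambda> (std_gen i))"

definition paths_from :: "('k, 'l) kgraph \<Rightarrow> 'l \<Rightarrow> 'l set" where
  \<comment> \<open>$v\Lambda$: the paths with range $v$\<close>
  "paths_from \<Lambda> v = {\<mu> \<in> paths \<Lambda>. rng \<Lambda> \<mu> = v}"

text \<open>The vertices are exactly the objects, i.e. the identity morphisms.\<close>

lemma vertices_eq_objects:
  assumes "k_graph \<Lambda>"
  shows "vertices \<Lambda> = rng \<Lambda> ` paths \<Lambda>" and "vertices \<Lambda> = src \<Lambda> ` paths \<Lambda>"
proof -
  have cat: "small_category \<Lambda>"
    and deg0: "\<And>\<mu>. \<mu> \<in> paths \<Lambda> \<Longrightarrow> deg \<Lambda> (rng \<Lambda> \<mu>) = 0 \<and> deg \<Lambda> (src \<Lambda> \<mu>) = 0"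
    using assms by (auto simp: k_graph_def)
  have id: "rng \<Lambda> \<rho> = \<rho> \<and> src \<Lambda> \<rho> = \<rho>" if \<rho>: "\<rho> \<in> vertices \<Lambda>" for \<rho>
  proof -
    have \<rho>': "\<rho> \<in> paths \<Lambda>" "deg \<Lambda> \<rho> = 0"
      using \<rho> by (auto simp: vertices_def paths_deg_def)
    let ?Q = "\<lambda>(\<mu>, \<nu>). \<mu> \<in> paths \<Lambda> \<and> \<nu> \<in> paths \<Lambda> \<and> src \<Lambda> \<mu> = rng \<Lambda> \<nu> \<and> \<rho> = \<mu> \<cdot>\<^bsub>\<Lambda>\<^esub> \<nu> \<and> deg \<Lambda> \<mu> = 0 \<and> deg \<Lambda> \<nu> = 0"
    have "\<forall>p q. deg \<Lambda> \<rho> = p + q \<longrightarrow>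
        (\<exists>!\<mu>\<nu>. case \<mu>\<nu> of (\<mu>, \<nu>) \<Rightarrow> \<mu> \<in> paths \<Lambda> \<and> \<nu> \<in> paths \<Lambda> \<and> src \<Lambda> \<mu> = rng \<Lambda> \<nu>
          \<and> \<rho> = \<mu> \<cdot>\<^bsub>\<Lambda>\<^esub> \<nu> \<and> deg \<Lambda> \<mu> = p \<and> deg \<Lambda> \<nu> = q)"
      using assms \<rho>'(1) unfolding k_graph_def by (elim conjE) (rule bspec)
    then have "\<exists>!\<mu>\<nu>. ?Q \<mu>\<nu>"
      using \<rho>'(2) by (simp only: add_0_left)
    moreover have "?Q (rng \<Lambda> \<rho>, \<rho>)" "?Q (\<rho>, src \<Lambda> \<rho>)"
      using cat deg0 \<rho>' by (auto simp: small_category_def)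
    ultimately have "(rng \<Lambda> \<rho>, \<rho>) = (\<rho>, src \<Lambda> \<rho>)" by blast
    then show ?thesis by simp
  qed
  show "vertices \<Lambda> = rng \<Lambda> ` paths \<Lambda>"
  proof
    show "vertices \<Lambda> \<subseteq> rng \<Lambda> ` paths \<Lambda>"
      using id by (force simp: vertices_def paths_deg_def)
    show "rng \<Lambda> ` paths \<Lambda> \<subseteq> vertices \<Lambda>"
      using cat deg0 by (auto simp: vertices_def paths_deg_def small_category_def)
  qed
  show "vertices \<Lambda> = src \<Lambda> ` paths \<Lambda>"
  proof
    show "vertices \<Lambda> \<subseteq> src \<Lambda> ` paths \<Lambda>"
      using id by (force simp: vertices_def paths_deg_def)
    show "src \<Lambda> ` paths \<Lambda> \<subseteq> vertices \<Lambda>"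
      using cat deg0 by (auto simp: vertices_def paths_deg_def small_category_def)
  qed
qed

definition finite_kgraph :: "('k, 'l) kgraph \<Rightarrow> bool" where
  "finite_kgraph \<Lambda> \<longleftrightarrow> (\<forall>p. finite (paths_deg \<Lambda> p))"

definition strongly_connected :: "('k, 'l) kgraph \<Rightarrow> bool" where
  "strongly_connected \<Lambda> \<longleftrightarrow>
    (\<forall>v\<in>vertices \<Lambda>. \<forall>w\<in>vertices \<Lambda>. {\<mu> \<in> paths \<Lambda>. rng \<Lambda> \<mu> = v \<and> src \<Lambda> \<mu> = w} \<noteq> {})"

definition min_ext :: "('k, 'l) kgraph \<Rightarrow> 'l \<Rightarrow> 'l \<Rightarrow> ('l \<times> 'l) set" where
  "min_ext \<Lambda> \<mu> \<nu> = {(\<eta>, \<zeta>). \<eta> \<in> paths_from \<Lambda> (src \<Lambda> \<mu>) \<and> \<zeta> \<in> paths_from \<Lambda> (src \<Lambda> \<nu>) \<and>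
     \<mu> \<cdot>\<^bsub>\<Lambda>\<^esub> \<eta> = \<nu> \<cdot>\<^bsub>\<Lambda>\<^esub> \<zeta> \<and> deg \<Lambda> (\<mu> \<cdot>\<^bsub>\<Lambda>\<^esub> \<eta>) = sup (deg \<Lambda> \<mu>) (deg \<Lambda> \<nu>)}"


section \<open>Groupoids and partial isomorphisms\<close>

text \<open>
  A unit of the groupoid is an element of \<open>units\<close>; \<open>unit_arr\<close> identifies it with an arrow.
\<close>

record ('v, 'g) groupoid =
  units :: "'v set"
  arrows :: "'g set"
  gdom :: "'g \<Rightarrow> 'v"
  gcod :: "'g \<Rightarrow> 'v"
  unit_arr :: "'v \<Rightarrow> 'g"
  gmult :: "'g \<Rightarrow> 'g \<Rightarrow> 'g"
  ginv :: "'g \<Rightarrow> 'g"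

definition groupoid :: "('v, 'g) groupoid \<Rightarrow> bool" where
  "groupoid G \<longleftrightarrow>
    (\<forall>v\<in>units G. unit_arr G v \<in> arrows G \<and> gdom G (unit_arr G v) = v \<and> gcod G (unit_arr G v) = v) \<and>
    (\<forall>g\<in>arrows G. gdom G g \<in> units G \<and> gcod G g \<in> units G
        \<and> gmult G g (unit_arr G (gdom G g)) = g \<and> gmult G (unit_arr G (gcod G g)) g = g
        \<and> ginv G g \<in> arrows G \<and> gdom G (ginv G g) = gcod G g \<and> gcod G (ginv G g) = gdom G g
        \<and> gmult G (ginv G g) g = unit_arr G (gdom G g) \<and> gmult G g (ginv G g) = unit_arr G (gcod G g)) \<and>
    (\<forall>g\<in>arrows G. \<forall>h\<in>arrows G. gdom G g = gcod G h \<longrightarrow>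
        gmult G g h \<in> arrows G \<and> gdom G (gmult G g h) = gdom G h \<and> gcod G (gmult G g h) = gcod G g) \<and>
    (\<forall>f\<in>arrows G. \<forall>g\<in>arrows G. \<forall>h\<in>arrows G. gdom G f = gcod G g \<and> gdom G g = gcod G h \<longrightarrow>
        gmult G (gmult G f g) h = gmult G f (gmult G g h))"

definition groupoid_hom :: "('v, 'g) groupoid \<Rightarrow> ('v, 'h) groupoid \<Rightarrow> ('g \<Rightarrow> 'h) \<Rightarrow> bool" where
  \<comment> \<open>homomorphisms which are the identity on the common unit space\<close>
  "groupoid_hom G H \<phi> \<longleftrightarrow>
    units G = units H \<and>
    (\<forall>g\<in>arrows G. \<phi> g \<in> arrows H \<and> gdom H (\<phi> g) = gdom G g \<and> gcod H (\<phi> g) = gcod G g) \<and>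
    (\<forall>v\<in>units G. \<phi> (unit_arr G v) = unit_arr H v) \<and>
    (\<forall>g\<in>arrows G. \<forall>h\<in>arrows G. gdom G g = gcod G h \<longrightarrow> \<phi> (gmult G g h) = gmult H (\<phi> g) (\<phi> h))"

text \<open>
  A partial isomorphism is a triple $(v, w, g)$. The map $g$ is extensional, so that equality of
  triples is equality of bijections $v\Lambda \to w\Lambda$.
\<close>

type_synonym 'l piso = "'l \<times> 'l \<times> ('l \<Rightarrow> 'l)"

definition partial_iso :: "('k, 'l) kgraph \<Rightarrow> 'l piso \<Rightarrow> bool" where
  "partial_iso \<Lambda> = (\<lambda>(v, w, g).
     v \<in> vertices \<Lambda> \<and> w \<in> vertices \<Lambda> \<and> g \<in> extensional (paths_from \<Lambda> v) \<and>
     bij_betw g (paths_from \<Lambda> v) (paths_from \<Lambda> w) \<and>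
     (\<forall>p. g ` (paths_from \<Lambda> v \<inter> paths_deg \<Lambda> p) = paths_from \<Lambda> w \<inter> paths_deg \<Lambda> p) \<and>
     (\<forall>\<mu>\<in>paths_from \<Lambda> v. \<forall>e\<in>edges \<Lambda> \<inter> paths_from \<Lambda> (src \<Lambda> \<mu>).
        \<exists>\<nu>\<in>paths_from \<Lambda> (src \<Lambda> (g \<mu>)). g (\<mu> \<cdot>\<^bsub>\<Lambda>\<^esub> e) = g \<mu> \<cdot>\<^bsub>\<Lambda>\<^esub> \<nu>))"

definition PIso :: "('k, 'l) kgraph \<Rightarrow> ('l, 'l piso) groupoid" where
  "PIso \<Lambda> = \<lparr>units = vertices \<Lambda>, arrows = Collect (partial_iso \<Lambda>),
     gdom = (\<lambda>(v, w, g). v), gcod = (\<lambda>(v, w, g). w),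
     unit_arr = (\<lambda>v. (v, v, restrict id (paths_from \<Lambda> v))),
     gmult = (\<lambda>(v, w, g) (v', w', g'). (v', w, compose (paths_from \<Lambda> v') g g')),
     ginv = (\<lambda>(v, w, g). (w, v, restrict (inv_into (paths_from \<Lambda> v) g) (paths_from \<Lambda> w)))\<rparr>"


section \<open>Self-similar groupoid actions\<close>

definition groupoid_action :: "('k, 'l) kgraph \<Rightarrow> ('l, 'g) groupoid \<Rightarrow> ('g \<Rightarrow> 'l piso) \<Rightarrow> bool" where
  "groupoid_action \<Lambda> G \<phi> \<longleftrightarrow> groupoid G \<and> units G = vertices \<Lambda> \<and> groupoid_hom G (PIso \<Lambda>) \<phi>"

definition faithful_action :: "('k, 'l) kgraph \<Rightarrow> ('l, 'g) groupoid \<Rightarrow> ('g \<Rightarrow> 'l piso) \<Rightarrow> bool" where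
  "faithful_action \<Lambda> G \<phi> \<longleftrightarrow> groupoid_action \<Lambda> G \<phi> \<and> inj_on \<phi> (arrows G)"

definition act :: "('g \<Rightarrow> 'l piso) \<Rightarrow> 'g \<Rightarrow> 'l \<Rightarrow> 'l" where
  "act \<phi> g \<mu> = snd (snd (\<phi> g)) \<mu>"

definition is_restriction ::
  "('k, 'l) kgraph \<Rightarrow> ('l, 'g) groupoid \<Rightarrow> ('g \<Rightarrow> 'l piso) \<Rightarrow> 'g \<Rightarrow> 'l \<Rightarrow> 'g \<Rightarrow> bool" where
  \<comment> \<open>the conditions on domain and codomain say that the right-hand side of the equation is defined\<close>
  "is_restriction \<Lambda> G \<phi> g e h \<longleftrightarrow>
     h \<in> arrows G \<and> gdom G h = src \<Lambda> e \<and> gcod G h = src \<Lambda> (act \<phi> g e) \<and>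
     (\<forall>\<mu>\<in>paths_from \<Lambda> (src \<Lambda> e). act \<phi> g (e \<cdot>\<^bsub>\<Lambda>\<^esub> \<mu>) = act \<phi> g e \<cdot>\<^bsub>\<Lambda>\<^esub> act \<phi> h \<mu>)"

definition self_similar_action ::
  "('k, 'l) kgraph \<Rightarrow> ('l, 'g) groupoid \<Rightarrow> ('g \<Rightarrow> 'l piso) \<Rightarrow> bool" where
  "self_similar_action \<Lambda> G \<phi> \<longleftrightarrow>
     faithful_action \<Lambda> G \<phi> \<and>
     (\<forall>g\<in>arrows G. \<forall>e\<in>edges \<Lambda> \<inter> paths_from \<Lambda> (gdom G g). \<exists>h. is_restriction \<Lambda> G \<phi> g e h)"

definition restr_edge ::
  "('k, 'l) kgraph \<Rightarrow> ('l, 'g) groupoid \<Rightarrow> ('g \<Rightarrow> 'l piso) \<Rightarrow> 'g \<Rightarrow> 'l \<Rightarrow> 'g" where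
  "restr_edge \<Lambda> G \<phi> g e = (THE h. is_restriction \<Lambda> G \<phi> g e h)"

fun edge_factorisation :: "('k, 'l) kgraph \<Rightarrow> 'l \<Rightarrow> 'l list \<Rightarrow> bool" where
  "edge_factorisation \<Lambda> \<mu> [] \<longleftrightarrow> \<mu> \<in> vertices \<Lambda>"
| "edge_factorisation \<Lambda> \<mu> (e # es) \<longleftrightarrow>
     e \<in> edges \<Lambda> \<and> (\<exists>\<nu>\<in>paths_from \<Lambda> (src \<Lambda> e). \<mu> = e \<cdot>\<^bsub>\<Lambda>\<^esub> \<nu> \<and> edge_factorisation \<Lambda> \<nu> es)"

definition restr ::
  "('k, 'l) kgraph \<Rightarrow> ('l, 'g) groupoid \<Rightarrow> ('g \<Rightarrow> 'l piso) \<Rightarrow> 'g \<Rightarrow> 'l \<Rightarrow> 'g" where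
  \<comment> \<open>independent of the chosen factorisation, by faithfulness\<close>
  "restr \<Lambda> G \<phi> g \<mu> = foldl (restr_edge \<Lambda> G \<phi>) g (SOME es. edge_factorisation \<Lambda> \<mu> es)"


section \<open>Infinite paths and periodicity\<close>

text \<open>
  Degree-preserving functors from $\Omega_k$, made extensional by the value \<^term>\<open>undefined\<close>
  off $\Omega_k$.
\<close>

type_synonym ('k, 'l) infpath = "'k degree \<times> 'k degree \<Rightarrow> 'l"

definition inf_paths :: "('k, 'l) kgraph \<Rightarrow> ('k, 'l) infpath set" where
  "inf_paths \<Lambda> = {x \<in> extensional {(p, q). p \<le> q}.
     (\<forall>p q. p \<le> q \<longrightarrow> x (p, q) \<in> paths \<Lambda> \<and> deg \<Lambda> (x (p, q)) = q - p
        \<and> rng \<Lambda> (x (p, q)) = x (p, p) \<and> src \<Lambda> (x (p, q)) = x (q, q)) \<and>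
     (\<forall>p q n. p \<le> q \<and> q \<le> n \<longrightarrow> x (p, n) = x (p, q) \<cdot>\<^bsub>\<Lambda>\<^esub> x (q, n))}"

definition inf_paths_from :: "('k, 'l) kgraph \<Rightarrow> 'l \<Rightarrow> ('k, 'l) infpath set" where
  "inf_paths_from \<Lambda> v = {x \<in> inf_paths \<Lambda>. x (0, 0) = v}"

definition shift :: "'k degree \<Rightarrow> ('k, 'l) infpath \<Rightarrow> ('k, 'l) infpath" where
  "shift n x = (\<lambda>(p, q). x (p + n, q + n))"

definition concat_inf :: "('k, 'l) kgraph \<Rightarrow> 'l \<Rightarrow> ('k, 'l) infpath \<Rightarrow> ('k, 'l) infpath" where
  "concat_inf \<Lambda> \<mu> y = (THE z. z \<in> inf_paths \<Lambda> \<and> z (0, deg \<Lambda> \<mu>) = \<mu> \<and> shift (deg \<Lambda> \<mu>) z = y)"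

definition act_inf ::
  "('k, 'l) kgraph \<Rightarrow> ('l, 'g) groupoid \<Rightarrow> ('g \<Rightarrow> 'l piso) \<Rightarrow> 'g \<Rightarrow> ('k, 'l) infpath \<Rightarrow> ('k, 'l) infpath" where
  "act_inf \<Lambda> G \<phi> g x =
     (\<lambda>(p, q). if p \<le> q then act \<phi> (restr \<Lambda> G \<phi> g (x (0, p))) (x (p, q)) else undefined)"

definition Per :: "('k, 'l) kgraph \<Rightarrow> ('l, 'g) groupoid \<Rightarrow> ('g \<Rightarrow> 'l piso) \<Rightarrow> ('k \<Rightarrow> int) set" where
  "Per \<Lambda> G \<phi> = {ddiff p q | p q.
     \<exists>g\<in>arrows G. \<forall>x\<in>inf_paths_from \<Lambda> (gdom G g). shift p x = shift q (act_inf \<Lambda> G \<phi> g x)}"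

definition Per_group :: "('k, 'l) kgraph \<Rightarrow> ('l, 'g) groupoid \<Rightarrow> ('g \<Rightarrow> 'l piso) \<Rightarrow> ('k \<Rightarrow> int) monoid" where
  "Per_group \<Lambda> G \<phi> = \<lparr>carrier = Per \<Lambda> G \<phi>, mult = (+), one = 0\<rparr>"

definition theta_h ::
  "('k, 'l) kgraph \<Rightarrow> ('l, 'g) groupoid \<Rightarrow> ('g \<Rightarrow> 'l piso) \<Rightarrow> 'k degree \<Rightarrow> 'k degree \<Rightarrow> 'l \<Rightarrow> 'l \<times> 'g" where
  \<comment> \<open>meaningful if \<open>ddiff p q \<in> Per \<Lambda> G \<phi>\<close> and \<open>\<mu> \<in> paths_deg \<Lambda> p\<close>\<close>
  "theta_h \<Lambda> G \<phi> p q \<mu> = (THE (\<nu>, h).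
     \<nu> \<in> paths_deg \<Lambda> q \<and> h \<in> arrows G \<and> gcod G h = src \<Lambda> \<mu> \<and> gdom G h = src \<Lambda> \<nu> \<and>
     (\<forall>x\<in>inf_paths_from \<Lambda> (gdom G h). concat_inf \<Lambda> \<mu> (act_inf \<Lambda> G \<phi> h x) = concat_inf \<Lambda> \<nu> x))"

definition theta ::
  "('k, 'l) kgraph \<Rightarrow> ('l, 'g) groupoid \<Rightarrow> ('g \<Rightarrow> 'l piso) \<Rightarrow> 'k degree \<Rightarrow> 'k degree \<Rightarrow> 'l \<Rightarrow> 'l" where
  "theta \<Lambda> G \<phi> p q \<mu> = fst (theta_h \<Lambda> G \<phi> p q \<mu>)"

definition hper ::
  "('k, 'l) kgraph \<Rightarrow> ('l, 'g) groupoid \<Rightarrow> ('g \<Rightarrow> 'l piso) \<Rightarrow> 'k degree \<Rightarrow> 'k degree \<Rightarrow> 'l \<Rightarrow> 'g" where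
  "hper \<Lambda> G \<phi> p q \<mu> = snd (theta_h \<Lambda> G \<phi> p q \<mu>)"


section \<open>Unital C*-algebras\<close>

definition complex_ring :: "complex ring" where
  "complex_ring = \<lparr>carrier = UNIV, mult = (*), one = 1, zero = 0, add = (+)\<rparr>"

record 'a cstar = "(complex, 'a) module" +
  adj :: "'a \<Rightarrow> 'a"
  nrm :: "'a \<Rightarrow> real"

locale cstar_algebra =
  fixes A :: "'a cstar" (structure)
  assumes ring: "ring A"
    and module: "module complex_ring A"
    and smult_mult_left: "\<lbrakk>x \<in> carrier A; y \<in> carrier A\<rbrakk> \<Longrightarrow> (c \<odot> x) \<otimes> y = c \<odot> (x \<otimes> y)"
    and smult_mult_right: "\<lbrakk>x \<in> carrier A; y \<in> carrier A\<rbrakk> \<Longrightarrow> x \<otimes> (c \<odot> y) = c \<odot> (x \<otimes> y)"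
    and adj_closed: "x \<in> carrier A \<Longrightarrow> adj A x \<in> carrier A"
    and adj_adj: "x \<in> carrier A \<Longrightarrow> adj A (adj A x) = x"
    and adj_add: "\<lbrakk>x \<in> carrier A; y \<in> carrier A\<rbrakk> \<Longrightarrow> adj A (x \<oplus> y) = adj A x \<oplus> adj A y"
    and adj_smult: "x \<in> carrier A \<Longrightarrow> adj A (c \<odot> x) = cnj c \<odot> adj A x"
    and adj_mult: "\<lbrakk>x \<in> carrier A; y \<in> carrier A\<rbrakk> \<Longrightarrow> adj A (x \<otimes> y) = adj A y \<otimes> adj A x"
    and nrm_nonneg: "x \<in> carrier A \<Longrightarrow> 0 \<le> nrm A x"
    and nrm_eq_0: "x \<in> carrier A \<Longrightarrow> nrm A x = 0 \<longleftrightarrow> x = \<zero>"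
    and nrm_triangle: "\<lbrakk>x \<in> carrier A; y \<in> carrier A\<rbrakk> \<Longrightarrow> nrm A (x \<oplus> y) \<le> nrm A x + nrm A y"
    and nrm_smult: "x \<in> carrier A \<Longrightarrow> nrm A (c \<odot> x) = cmod c * nrm A x"
    and nrm_mult: "\<lbrakk>x \<in> carrier A; y \<in> carrier A\<rbrakk> \<Longrightarrow> nrm A (x \<otimes> y) \<le> nrm A x * nrm A y"
    and cstar_identity: "x \<in> carrier A \<Longrightarrow> nrm A (adj A x \<otimes> x) = (nrm A x)\<^sup>2"
    and complete: "\<lbrakk>\<And>n::nat. s n \<in> carrier A;
        \<And>\<epsilon>::real. \<epsilon> > 0 \<Longrightarrow> \<exists>N. \<forall>m\<ge>N. \<forall>n\<ge>N. nrm A (s m \<ominus> s n) < \<epsilon>\<rbrakk>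
      \<Longrightarrow> \<exists>a\<in>carrier A. (\<lambda>n. nrm A (s n \<ominus> a)) \<longlonglongrightarrow> 0"

definition star_hom :: "'a cstar \<Rightarrow> 'b cstar \<Rightarrow> ('a \<Rightarrow> 'b) set" where
  "star_hom A B = {\<psi> \<in> ring_hom A B.
     (\<forall>c. \<forall>x\<in>carrier A. \<psi> (c \<odot>\<^bsub>A\<^esub> x) = c \<odot>\<^bsub>B\<^esub> \<psi> x) \<and> (\<forall>x\<in>carrier A. \<psi> (adj A x) = adj B (\<psi> x))}"

definition cstar_subalgebra :: "'a set \<Rightarrow> 'a cstar \<Rightarrow> bool" where
  "cstar_subalgebra S A \<longleftrightarrow>
     S \<subseteq> carrier A \<and> \<zero>\<^bsub>A\<^esub> \<in> S \<and>
     (\<forall>x\<in>S. \<forall>y\<in>S. x \<oplus>\<^bsub>A\<^esub> y \<in> S \<and> x \<otimes>\<^bsub>A\<^esub> y \<in> S) \<and>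
     (\<forall>c. \<forall>x\<in>S. c \<odot>\<^bsub>A\<^esub> x \<in> S) \<and> (\<forall>x\<in>S. adj A x \<in> S) \<and>
     (\<forall>s a. (\<forall>n::nat. s n \<in> S) \<and> a \<in> carrier A \<and> (\<lambda>n. nrm A (s n \<ominus>\<^bsub>A\<^esub> a)) \<longlonglongrightarrow> 0 \<longrightarrow> a \<in> S)"

definition generates :: "'a set \<Rightarrow> 'a cstar \<Rightarrow> bool" where
  "generates X A \<longleftrightarrow> (\<forall>S. cstar_subalgebra S A \<and> X \<subseteq> S \<longrightarrow> S = carrier A)"

definition partial_isometry :: "'a cstar \<Rightarrow> 'a \<Rightarrow> bool" where
  "partial_isometry A x \<longleftrightarrow> x \<in> carrier A \<and> x \<otimes>\<^bsub>A\<^esub> adj A x \<otimes>\<^bsub>A\<^esub> x = x"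

definition orthogonal_projections :: "'a cstar \<Rightarrow> ('i \<Rightarrow> 'a) \<Rightarrow> 'i set \<Rightarrow> bool" where
  "orthogonal_projections A P I \<longleftrightarrow>
     (\<forall>i\<in>I. P i \<in> carrier A \<and> adj A (P i) = P i \<and> P i \<otimes>\<^bsub>A\<^esub> P i = P i) \<and>
     (\<forall>i\<in>I. \<forall>j\<in>I. i \<noteq> j \<longrightarrow> P i \<otimes>\<^bsub>A\<^esub> P j = \<zero>\<^bsub>A\<^esub>)"

definition centre :: "'a cstar \<Rightarrow> 'a set" where
  "centre A = {z \<in> carrier A. \<forall>x\<in>carrier A. z \<otimes>\<^bsub>A\<^esub> x = x \<otimes>\<^bsub>A\<^esub> z}"

definition central_unitaries :: "'a cstar \<Rightarrow> 'a monoid" where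
  "central_unitaries A =
     \<lparr>carrier = {z \<in> centre A. adj A z \<otimes>\<^bsub>A\<^esub> z = \<one>\<^bsub>A\<^esub> \<and> z \<otimes>\<^bsub>A\<^esub> adj A z = \<one>\<^bsub>A\<^esub>},
      mult = mult A, one = \<one>\<^bsub>A\<^esub>\<rparr>"


section \<open>The Cuntz--Pimsner algebra\<close>

definition unitary_rep :: "('v, 'g) groupoid \<Rightarrow> 'a cstar \<Rightarrow> ('g \<Rightarrow> 'a) \<Rightarrow> bool" where
  "unitary_rep G A U \<longleftrightarrow>
     (\<forall>g\<in>arrows G. partial_isometry A (U g)) \<and>
     orthogonal_projections A (\<lambda>v. U (unit_arr G v)) (units G) \<and>
     (\<forall>g\<in>arrows G. adj A (U g) = U (ginv G g)) \<and>
     (\<forall>g\<in>arrows G. \<forall>h\<in>arrows G.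
        U g \<otimes>\<^bsub>A\<^esub> U h = (if gdom G g = gcod G h then U (gmult G g h) else \<zero>\<^bsub>A\<^esub>))"

text \<open>The sums below are over finite sets when $\Lambda$ is finite, which is the only case used.\<close>

definition TCK_family :: "('k, 'l) kgraph \<Rightarrow> 'a cstar \<Rightarrow> ('l \<Rightarrow> 'a) \<Rightarrow> bool" where
  "TCK_family \<Lambda> A T \<longleftrightarrow>
     (\<forall>\<mu>\<in>paths \<Lambda>. partial_isometry A (T \<mu>)) \<and>
     orthogonal_projections A T (vertices \<Lambda>) \<and>
     (\<forall>\<mu>\<in>paths \<Lambda>. \<forall>\<nu>\<in>paths \<Lambda>. src \<Lambda> \<mu> = rng \<Lambda> \<nu> \<longrightarrow> T \<mu> \<otimes>\<^bsub>A\<^esub> T \<nu> = T (\<mu> \<cdot>\<^bsub>\<Lambda>\<^esub> \<nu>)) \<and>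
     (\<forall>\<mu>\<in>paths \<Lambda>. \<forall>\<nu>\<in>paths \<Lambda>.
        adj A (T \<mu>) \<otimes>\<^bsub>A\<^esub> T \<nu> = (\<Oplus>\<^bsub>A\<^esub>\<eta>\<zeta>\<in>min_ext \<Lambda> \<mu> \<nu>. T (fst \<eta>\<zeta>) \<otimes>\<^bsub>A\<^esub> adj A (T (snd \<eta>\<zeta>))))"

definition CK_family :: "('k, 'l) kgraph \<Rightarrow> 'a cstar \<Rightarrow> ('l \<Rightarrow> 'a) \<Rightarrow> bool" where
  "CK_family \<Lambda> A T \<longleftrightarrow>
     TCK_family \<Lambda> A T \<and>
     (\<forall>v\<in>vertices \<Lambda>. \<forall>p. T v = (\<Oplus>\<^bsub>A\<^esub>\<mu>\<in>paths_from \<Lambda> v \<inter> paths_deg \<Lambda> p. T \<mu> \<otimes>\<^bsub>A\<^esub> adj A (T \<mu>)))"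

definition CP_family ::
  "('k, 'l) kgraph \<Rightarrow> ('l, 'g) groupoid \<Rightarrow> ('g \<Rightarrow> 'l piso) \<Rightarrow> 'a cstar \<Rightarrow> ('g \<Rightarrow> 'a) \<Rightarrow> ('l \<Rightarrow> 'a) \<Rightarrow> bool" where
  "CP_family \<Lambda> G \<phi> A U T \<longleftrightarrow>
     unitary_rep G A U \<and> CK_family \<Lambda> A T \<and>
     (\<forall>v\<in>vertices \<Lambda>. U (unit_arr G v) = T v) \<and>
     (\<Oplus>\<^bsub>A\<^esub>v\<in>vertices \<Lambda>. T v) = \<one>\<^bsub>A\<^esub> \<and>
     (\<forall>g\<in>arrows G. \<forall>\<mu>\<in>paths \<Lambda>. U g \<otimes>\<^bsub>A\<^esub> T \<mu> =
        (if gdom G g = rng \<Lambda> \<mu> then T (act \<phi> g \<mu>) \<otimes>\<^bsub>A\<^esub> U (restr \<Lambda> G \<phi> g \<mu>) else \<zero>\<^bsub>A\<^esub>))"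

text \<open>
  The universal property needs a fixed type carrying the test algebras. Each element of a C*-algebra
  generated by a family $(U, T)$ is the limit of a sequence of *-polynomials in the $U_g$ and $T_\mu$;
  a *-polynomial is encoded below as a list of coefficients and words, where the Boolean marks adjoints.
  Hence every C*-algebra generated by such a family has an isomorphic copy carried by a
  subset of the type \<open>('g, 'l) test\<close>, and the universal property for these copies is the universal
  property for all C*-algebras.
\<close>

type_synonym ('g, 'l) test = "nat \<Rightarrow> (complex \<times> (('g + 'l) \<times> bool) list) list"

definition cuntz_pimsner_algebra ::
  "('k, 'l) kgraph \<Rightarrow> ('l, 'g) groupoid \<Rightarrow> ('g \<Rightarrow> 'l piso) \<Rightarrow> 'a cstar \<Rightarrow> ('g \<Rightarrow> 'a) \<Rightarrow> ('l \<Rightarrow> 'a) \<Rightarrow> bool" where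
  "cuntz_pimsner_algebra \<Lambda> G \<phi> A u t \<longleftrightarrow>
     cstar_algebra A \<and> CP_family \<Lambda> G \<phi> A u t \<and> generates (u ` arrows G \<union> t ` paths \<Lambda>) A \<and>
     (\<forall>(B :: ('g, 'l) test cstar) U T. cstar_algebra B \<and> CP_family \<Lambda> G \<phi> B U T \<longrightarrow>
        (\<exists>\<psi>\<in>star_hom A B. (\<forall>g\<in>arrows G. \<psi> (u g) = U g) \<and> (\<forall>\<mu>\<in>paths \<Lambda>. \<psi> (t \<mu>) = T \<mu>)))"

end

theory Submission
  imports Defs
begin

text \<open>
  A triple \<open>(\<mu>, h, \<nu>)\<close> with \<open>\<mu>(h \<cdot> x) = \<nu>x\<close> for all infinite paths \<open>x\<close> from \<open>s \<nu>\<close> is called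
  cycline (after Li and Yang). Strong connectivity makes every period of the action produce, for each
  \<open>\<mu>\<close> of degree \<open>p\<close>, a unique cycline \<open>(\<mu>, h, \<nu>)\<close> with \<open>d \<nu> = q\<close>, and cycline triples are closed
  under inversion, composition, extension on either side and the action of \<open>G\<close>.

  By the Cuntz--Krieger relation an element \<open>x\<close> of the algebra is determined by the products
  \<open>x t\<^sub>\<nu>\<close> with \<open>d \<nu> = q\<close>, and \<open>V\<^bsub>p-q\<^esub> t\<^sub>\<nu> = t\<^sub>\<mu> u\<^sub>h\<close> for cycline \<open>(\<mu>, h, \<nu>)\<close>. So each closure property of cycline
  triples becomes an identity for \<open>V\<close>: independence of the pair \<open>(p, q)\<close>, multiplicativity, and
  commutation with the generators \<open>t\<^sub>\<lambda>\<close> and \<open>u\<^sub>g\<close>.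
\<close>

section \<open>Higher-rank graphs and their infinite paths\<close>

text \<open>A relation on triples, in place of the functions \<theta> and h cut out by definite
  descriptions, puts the two outer paths on an equal footing: inversion exchanges them, so one
  existence and one uniqueness statement serve both sides, and \<theta> is seen to be a bijection of
  \<Lambda>^p onto \<Lambda>^q. Degrees dictate the order of the identities for V. Multiplication by
  t_\<lambda> turns test paths of degree q into paths of degree q + d \<lambda>, so V must be
  invariant under a common shift of p and q before commutation with t_\<lambda> can be tested. The
  same invariance makes V depend on the difference alone, so that two periods may be written with a
  common middle degree, where products of V become compositions of triples. Commutation with the
  generators reaches the whole algebra because the centraliser of a unitary is closed under
  adjoints; centrality therefore rests on unitarity.\<close>

lemma degree_add_diff: "p \<le> q \<Longrightarrow> p + (q - p) = q" for p q :: "'k degree"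
  by (auto simp: le_fun_def fun_eq_iff)

lemma degree_le_add: "p \<le> p + q" "p \<le> q + p" for p q :: "'k degree"
  by (auto simp: le_fun_def)

lemma ddiff_self: "ddiff p p = 0"
  by (auto simp: ddiff_def)

lemma ddiff_add: "ddiff p q + ddiff q n = ddiff p n"
  by (auto simp: ddiff_def)

lemma ddiff_shift: "ddiff (p + n) (q + n) = ddiff p q"
  by (auto simp: ddiff_def)

lemma ddiff_eq_iff: "ddiff p q = ddiff p' q' \<longleftrightarrow> p + q' = p' + q"
  by (auto simp: ddiff_def fun_eq_iff) (smt (verit) of_nat_add of_nat_eq_iff)+

locale higher_rank_graph =
  fixes \<Lambda> :: "('k::finite, 'l) kgraph"
  assumes k_graph: "k_graph \<Lambda>"
begin

abbreviation comp_paths (infixl "\<bullet>" 70) where "\<mu> \<bullet> \<nu> \<equiv> cmp \<Lambda> \<mu> \<nu>"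
abbreviation P where "P \<equiv> paths \<Lambda>"
abbreviation r where "r \<equiv> rng \<Lambda>"
abbreviation s where "s \<equiv> src \<Lambda>"
abbreviation d where "d \<equiv> deg \<Lambda>"

lemma path_simps [simp]:
  assumes "\<mu> \<in> P"
  shows "r \<mu> \<in> P" "s \<mu> \<in> P" "r (r \<mu>) = r \<mu>" "s (r \<mu>) = r \<mu>" "r (s \<mu>) = s \<mu>" "s (s \<mu>) = s \<mu>"
    "r \<mu> \<bullet> \<mu> = \<mu>" "\<mu> \<bullet> s \<mu> = \<mu>" "d (r \<mu>) = 0" "d (s \<mu>) = 0"
  using k_graph assms by (auto simp: k_graph_def small_category_def)

lemma comp_simps [simp]:
  assumes "\<mu> \<in> P" "\<nu> \<in> P" "s \<mu> = r \<nu>"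
  shows "\<mu> \<bullet> \<nu> \<in> P" "r (\<mu> \<bullet> \<nu>) = r \<mu>" "s (\<mu> \<bullet> \<nu>) = s \<nu>" "d (\<mu> \<bullet> \<nu>) = d \<mu> + d \<nu>"
  using k_graph assms by (auto simp: k_graph_def small_category_def)

lemma comp_assoc:
  assumes "\<mu> \<in> P" "\<nu> \<in> P" "\<rho> \<in> P" "s \<mu> = r \<nu>" "s \<nu> = r \<rho>"
  shows "(\<mu> \<bullet> \<nu>) \<bullet> \<rho> = \<mu> \<bullet> (\<nu> \<bullet> \<rho>)"
proof -
  have "\<forall>\<mu>\<in>P. \<forall>\<nu>\<in>P. \<forall>\<rho>\<in>P. s \<mu> = r \<nu> \<and> s \<nu> = r \<rho> \<longrightarrow> (\<mu> \<bullet> \<nu>) \<bullet> \<rho> = \<mu> \<bullet> (\<nu> \<bullet> \<rho>)"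
    using k_graph unfolding k_graph_def small_category_def by (elim conjE)
  then show ?thesis using assms by blast
qed

lemma ex1_factorisation:
  assumes "\<rho> \<in> P" "d \<rho> = p + q"
  shows "\<exists>!(\<mu>\<nu> :: 'l \<times> 'l). case \<mu>\<nu> of (\<mu>, \<nu>) \<Rightarrow>
    \<mu> \<in> P \<and> \<nu> \<in> P \<and> s \<mu> = r \<nu> \<and> \<rho> = \<mu> \<bullet> \<nu> \<and> d \<mu> = p \<and> d \<nu> = q"
proof -
  have "\<forall>p q. d \<rho> = p + q \<longrightarrow> (\<exists>!(\<mu>\<nu> :: 'l \<times> 'l). case \<mu>\<nu> of (\<mu>, \<nu>) \<Rightarrow>
      \<mu> \<in> P \<and> \<nu> \<in> P \<and> s \<mu> = r \<nu> \<and> \<rho> = \<mu> \<bullet> \<nu> \<and> d \<mu> = p \<and> d \<nu> = q)"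
    using k_graph assms(1) unfolding k_graph_def by (elim conjE) (rule bspec)
  then show ?thesis using assms(2) by blast
qed

lemma factorise:
  assumes "\<rho> \<in> P" "d \<rho> = p + q"
  obtains \<mu> \<nu> where "\<mu> \<in> P" "\<nu> \<in> P" "s \<mu> = r \<nu>" "\<rho> = \<mu> \<bullet> \<nu>" "d \<mu> = p" "d \<nu> = q"
  using ex1_implies_ex[OF ex1_factorisation[OF assms]] by (elim exE) auto

text \<open>Unique factorisation as a cancellation law: degrees are additive, so equal first degrees
  force equal second degrees, and both pairs factor one path in the same way.\<close>

lemma comp_cancel:
  assumes "\<mu> \<in> P" "\<nu> \<in> P" "s \<mu> = r \<nu>" "\<mu>' \<in> P" "\<nu>' \<in> P" "s \<mu>' = r \<nu>'"
    and "\<mu> \<bullet> \<nu> = \<mu>' \<bullet> \<nu>'" "d \<mu> = d \<mu>'"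
  shows "\<mu> = \<mu>'" "\<nu> = \<nu>'"
proof -
  have "d \<mu> + d \<nu> = d \<mu>' + d \<nu>'" using assms by (metis comp_simps(4))
  then have "d \<nu> = d \<nu>'" using assms(8) by (simp add: fun_eq_iff)
  let ?Q = "\<lambda>(\<alpha>, \<beta>). \<alpha> \<in> P \<and> \<beta> \<in> P \<and> s \<alpha> = r \<beta> \<and> \<mu> \<bullet> \<nu> = \<alpha> \<bullet> \<beta> \<and> d \<alpha> = d \<mu> \<and> d \<beta> = d \<nu>"
  have "\<exists>!\<alpha>\<beta>. ?Q \<alpha>\<beta>"
    by (rule ex1_factorisation[OF comp_simps(1,4)[OF assms(1-3)]])
  moreover have "?Q (\<mu>, \<nu>)" "?Q (\<mu>', \<nu>')"
    using assms \<open>d \<nu> = d \<nu>'\<close> by auto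
  ultimately have "(\<mu>, \<nu>) = (\<mu>', \<nu>')" by blast
  then show "\<mu> = \<mu>'" "\<nu> = \<nu>'" by auto
qed

lemma in_paths_from: "\<mu> \<in> paths_from \<Lambda> v \<longleftrightarrow> \<mu> \<in> P \<and> r \<mu> = v"
  by (auto simp: paths_from_def)

lemma in_paths_deg: "\<mu> \<in> paths_deg \<Lambda> p \<longleftrightarrow> \<mu> \<in> P \<and> d \<mu> = p"
  by (auto simp: paths_deg_def)

lemma vertexD:
  assumes "v \<in> vertices \<Lambda>"
  shows "v \<in> P" "d v = 0" "r v = v" "s v = v"
  using assms vertices_eq_objects(1)[OF k_graph] by auto

lemma rng_src_in_vertices [simp]:
  assumes "\<mu> \<in> P" shows "r \<mu> \<in> vertices \<Lambda>" "s \<mu> \<in> vertices \<Lambda>"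
  using vertices_eq_objects[OF k_graph] assms by auto

lemma vertexI: "\<mu> \<in> P \<Longrightarrow> d \<mu> = 0 \<Longrightarrow> \<mu> \<in> vertices \<Lambda>"
  by (auto simp: vertices_def paths_deg_def)

text \<open>Initial segments of a fixed path are determined by their degrees. Coherent families of
  them are the raw material from which infinite paths are built.\<close>

definition is_prefix :: "'l \<Rightarrow> 'l \<Rightarrow> bool" where
  "is_prefix \<alpha> \<rho> \<longleftrightarrow> \<alpha> \<in> P \<and> (\<exists>\<beta>\<in>P. s \<alpha> = r \<beta> \<and> \<rho> = \<alpha> \<bullet> \<beta>)"

lemma is_prefix_comp: "\<alpha> \<in> P \<Longrightarrow> \<beta> \<in> P \<Longrightarrow> s \<alpha> = r \<beta> \<Longrightarrow> is_prefix \<alpha> (\<alpha> \<bullet> \<beta>)"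
  by (auto simp: is_prefix_def)

lemma is_prefix_trans: "is_prefix \<alpha> \<beta> \<Longrightarrow> is_prefix \<beta> \<gamma> \<Longrightarrow> is_prefix \<alpha> \<gamma>"
  unfolding is_prefix_def by (metis comp_assoc comp_simps(1-3))

lemma is_prefix_unique: "is_prefix \<alpha> \<rho> \<Longrightarrow> is_prefix \<beta> \<rho> \<Longrightarrow> d \<alpha> = d \<beta> \<Longrightarrow> \<alpha> = \<beta>"
  unfolding is_prefix_def by (metis comp_cancel(1))

lemma ex_prefix:
  assumes "\<rho> \<in> P" "n \<le> d \<rho>"
  obtains \<alpha> where "is_prefix \<alpha> \<rho>" "d \<alpha> = n"
proof -
  obtain \<mu> \<nu> where "\<mu> \<in> P" "\<nu> \<in> P" "s \<mu> = r \<nu>" "\<rho> = \<mu> \<bullet> \<nu>" "d \<mu> = n"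
    using factorise[OF assms(1), of n "d \<rho> - n"] degree_add_diff[OF assms(2)] by metis
  then show ?thesis using that is_prefix_comp by blast
qed

text \<open>The prefix of \<beta> of degree \<open>d \<alpha>\<close> is also a prefix of \<rho>,
  hence equals \<alpha>.\<close>

lemma is_prefix_mono:
  assumes "is_prefix \<alpha> \<rho>" "is_prefix \<beta> \<rho>" "d \<alpha> \<le> d \<beta>"
  shows "is_prefix \<alpha> \<beta>"
proof -
  obtain \<gamma> where "is_prefix \<gamma> \<beta>" "d \<gamma> = d \<alpha>"
    using ex_prefix[of \<beta> "d \<alpha>"] assms unfolding is_prefix_def by metis
  then show ?thesis using is_prefix_trans is_prefix_unique assms by metis
qed

lemma is_prefix_closed: "is_prefix \<alpha> \<rho> \<Longrightarrow> \<alpha> \<in> P" "is_prefix \<alpha> \<rho> \<Longrightarrow> \<rho> \<in> P"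
  "is_prefix \<alpha> \<rho> \<Longrightarrow> r \<rho> = r \<alpha>"
  by (auto simp: is_prefix_def)

lemma is_prefix_comp_mono:
  assumes "\<mu> \<in> P" "s \<mu> = r \<alpha>" "is_prefix \<alpha> \<beta>"
  shows "is_prefix (\<mu> \<bullet> \<alpha>) (\<mu> \<bullet> \<beta>)"
  using assms unfolding is_prefix_def by (metis comp_assoc comp_simps(1,3))

section \<open>Infinite paths and their initial segments\<close>

lemma infpathD:
  assumes "x \<in> inf_paths \<Lambda>"
  shows "p \<le> q \<Longrightarrow> x (p, q) \<in> P" "p \<le> q \<Longrightarrow> d (x (p, q)) = q - p"
    "p \<le> q \<Longrightarrow> r (x (p, q)) = x (p, p)" "p \<le> q \<Longrightarrow> s (x (p, q)) = x (q, q)"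
    "p \<le> q \<Longrightarrow> q \<le> n \<Longrightarrow> x (p, n) = x (p, q) \<bullet> x (q, n)"
    "x \<in> extensional {(p, q). p \<le> q}"
  using assms unfolding inf_paths_def by blast+

lemma infpath_segment_unique:
  assumes "x \<in> inf_paths \<Lambda>" "p \<le> q" "\<alpha> \<in> P" "\<beta> \<in> P" "s \<alpha> = r \<beta>" "x (0, q) = \<alpha> \<bullet> \<beta>" "d \<alpha> = p"
  shows "x (0, p) = \<alpha>" "x (p, q) = \<beta>"
proof -
  have z: "0 \<le> p" "0 \<le> q" by (auto simp: le_fun_def)
  have "x (0, p) \<bullet> x (p, q) = \<alpha> \<bullet> \<beta>" "d (x (0, p)) = d \<alpha>"
    using infpathD(2)[OF assms(1) z(1)] infpathD(5)[OF assms(1) z(1) assms(2)] assms by (auto simp: fun_eq_iff)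
  then show "x (0, p) = \<alpha>" "x (p, q) = \<beta>"
    using comp_cancel[of "x (0, p)" "x (p, q)" \<alpha> \<beta>] infpathD[OF assms(1)] assms z by metis+
qed

text \<open>A long segment \<open>x (0, m)\<close> determines \<open>x (0, q)\<close> for
  \<open>q \<le> m\<close> and then \<open>x (p, q)\<close> by unique factorisation, so agreement on
  a cofinal set of degrees is enough.\<close>

lemma infpath_eqI:
  assumes x: "x \<in> inf_paths \<Lambda>" and y: "y \<in> inf_paths \<Lambda>" and eq: "\<And>n. \<exists>m\<ge>n. x (0, m) = y (0, m)"
  shows "x = y"
proof (rule extensionalityI[OF infpathD(6)[OF x] infpathD(6)[OF y]])
  fix pq :: "'k degree \<times> 'k degree"
  assume "pq \<in> {(p, q). p \<le> q}"
  then obtain p q where pq: "pq = (p, q)" "p \<le> q" by auto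
  have z: "0 \<le> q" "0 \<le> p" by (auto simp: le_fun_def)
  obtain m where m: "m \<ge> q" "x (0, m) = y (0, m)" using eq by blast
  have dd: "d (y (0, n)) = n" for n using infpathD(2)[OF y, of 0 n] by (simp add: le_fun_def fun_eq_iff)
  have "x (0, q) = y (0, q)"
    by (rule infpath_segment_unique(1)[OF x m(1), of _ "y (q, m)"])
      (use infpathD(1-4)[OF y] z m dd infpathD(5)[OF y z(1) m(1)] in auto)
  then have "x (p, q) = y (p, q)"
    by (intro infpath_segment_unique(2)[OF x pq(2), of "y (0, p)"])
      (use infpathD(1-4)[OF y] z pq dd infpathD(5)[OF y z(2) pq(2)] in auto)
  then show "x pq = y pq" using pq by simp
qed

text \<open>The segment from p to q is what remains of \<open>X q\<close> after cancelling
  \<open>X p\<close>. Identities and composites are checked by prepending \<open>X p\<close> and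
  cancelling it again.\<close>

lemma infpath_from_prefixes:
  assumes X: "\<And>n. X n \<in> P" "\<And>n. d (X n) = n" and coh: "\<And>m n. m \<le> n \<Longrightarrow> is_prefix (X m) (X n)"
  obtains x where "x \<in> inf_paths \<Lambda>" "\<And>n. x (0, n) = X n"
proof -
  have "\<exists>\<beta>. \<beta> \<in> P \<and> s (X p) = r \<beta> \<and> X q = X p \<bullet> \<beta>" if "p \<le> q" for p q
    using coh[OF that] by (auto simp: is_prefix_def)
  then obtain b where b: "\<And>p q. p \<le> q \<Longrightarrow> b p q \<in> P \<and> s (X p) = r (b p q) \<and> X q = X p \<bullet> b p q"
    by metis
  define x where "x = (\<lambda>(p, q). if p \<le> q then b p q else undefined)"
  have bd: "d (b p q) = q - p" if "p \<le> q" for p q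
  proof -
    have "q = p + d (b p q)" using b[OF that] X comp_simps(4) by metis
    then show ?thesis by (simp add: fun_eq_iff)
  qed
  have bpp: "b p p = s (X p)" for p
  proof (rule comp_cancel(2))
    show "X p \<bullet> b p p = X p \<bullet> s (X p)"
      using b[of p p] path_simps(8)[OF X(1)[of p]] by (metis order_refl)
  qed (use b[of p p] X in simp_all)
  have bs: "s (b p q) = s (X q)" if "p \<le> q" for p q
    using b[OF that] X comp_simps(3) by metis
  have bc: "b p n = b p q \<bullet> b q n" if "p \<le> q" "q \<le> n" for p q n
  proof (rule comp_cancel(2))
    have pn: "p \<le> n" using that by simp
    have mem: "b p q \<in> P" "b q n \<in> P" and comp: "s (X p) = r (b p q)" "s (b p q) = r (b q n)"
      using b[OF that(1)] b[OF that(2)] bs[OF that(1)] by metis+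
    show "s (X p) = r (b p n)" "b p n \<in> P" using b[OF pn] by blast+
    show "s (X p) = r (b p q \<bullet> b q n)" "b p q \<bullet> b q n \<in> P" using mem comp by auto
    have "X p \<bullet> (b p q \<bullet> b q n) = (X p \<bullet> b p q) \<bullet> b q n"
      using mem comp X(1) by (intro comp_assoc[symmetric]) auto
    then show "X p \<bullet> b p n = X p \<bullet> (b p q \<bullet> b q n)"
      using b[OF pn] b[OF that(1)] b[OF that(2)] by metis
  qed (use X in auto)
  have "x \<in> inf_paths \<Lambda>"
    unfolding inf_paths_def
  proof (intro CollectI conjI allI impI; (elim conjE)?)
    show "x \<in> extensional {(p, q). p \<le> q}" by (auto simp: x_def extensional_def)
  next
    fix p q :: "'k degree" assume "p \<le> q"
    then show "x (p, q) \<in> P" "d (x (p, q)) = q - p" "r (x (p, q)) = x (p, p)" "s (x (p, q)) = x (q, q)"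
      using b[of p q] bd[of p q] bs[of p q] by (simp_all add: x_def bpp)
  next
    fix p q n :: "'k degree" assume "p \<le> q" "q \<le> n"
    moreover from this have "p \<le> n" by simp
    ultimately show "x (p, n) = x (p, q) \<bullet> x (q, n)" by (simp add: x_def bc[symmetric])
  qed
  moreover have "x (0, n) = X n" for n
  proof -
    have z: "0 \<le> n" by (simp add: le_fun_def)
    \<comment> \<open>\<open>X 0\<close> is an identity, so cancelling it from \<open>X n\<close>
      leaves \<open>X n\<close>.\<close>
    have "X 0 \<in> vertices \<Lambda>" using X by (intro vertexI) auto
    then have "X 0 = s (X 0)" using vertexD by metis
    then have "X n = b 0 n" using b[OF z] path_simps(7) by metis
    then show ?thesis by (simp add: x_def z)
  qed
  ultimately show ?thesis using that by blast
qed

section \<open>Shift and concatenation\<close>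

abbreviation I where "I \<equiv> inf_paths_from \<Lambda>"

lemma in_I: "x \<in> I v \<longleftrightarrow> x \<in> inf_paths \<Lambda> \<and> x (0, 0) = v"
  by (simp add: inf_paths_from_def)

lemma initial_segment:
  assumes "x \<in> I v"
  shows "x (0, n) \<in> P" "d (x (0, n)) = n" "r (x (0, n)) = v"
  using infpathD(1-4)[of x 0 n] assms by (auto simp: in_I le_fun_def fun_eq_iff)

lemma shift_in_I:
  assumes "x \<in> I v"
  shows "shift n x \<in> I (s (x (0, n)))"
proof -
  have x: "x \<in> inf_paths \<Lambda>" using assms by (simp add: in_I)
  have z: "0 \<le> n" by (simp add: le_fun_def)
  have e: "(p :: 'k degree) + n \<le> q + n \<longleftrightarrow> p \<le> q" for p q by (simp add: le_fun_def)
  have "shift n x \<in> inf_paths \<Lambda>"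
    unfolding inf_paths_def
  proof (intro CollectI conjI allI impI; (elim conjE)?)
    show "shift n x \<in> extensional {(p, q). p \<le> q}"
      using infpathD(6)[OF x] by (auto simp: extensional_def shift_def e)
    show "shift n x (p, m) = shift n x (p, q) \<bullet> shift n x (q, m)" if "p \<le> q" "q \<le> m" for p q m
      using infpathD(5)[OF x] that by (simp add: e shift_def)
  qed (use infpathD(1-4)[OF x] in \<open>auto simp: e shift_def fun_eq_iff\<close>)
  then show ?thesis using infpathD(4)[OF x z] by (simp add: in_I shift_def)
qed

text \<open>Only the segments of degree \<open>d \<mu> + n\<close> are prescribed, namely
  \<open>Y n\<close>. Since \<open>Y n\<close> has degree at least n, its prefix \<open>Z n\<close>
  of degree n fills in the rest. Uniqueness holds because the degrees \<open>d \<mu> + n\<close> are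
  cofinal.\<close>

lemma concat_inf_props:
  assumes "\<mu> \<in> P" "x \<in> I (s \<mu>)"
  shows "concat_inf \<Lambda> \<mu> x \<in> I (r \<mu>)"
    and "concat_inf \<Lambda> \<mu> x (0, d \<mu> + n) = \<mu> \<bullet> x (0, n)"
    and "concat_inf \<Lambda> \<mu> x (0, d \<mu>) = \<mu>"
    and "shift (d \<mu>) (concat_inf \<Lambda> \<mu> x) = x"
proof -
  note ini = initial_segment[OF assms(2)]
  have x: "x \<in> inf_paths \<Lambda>" and x0: "x (0, 0) = s \<mu>" using assms by (simp_all add: in_I)
  define Y where "Y n = \<mu> \<bullet> x (0, n)" for n
  have Y: "Y n \<in> P" "d (Y n) = d \<mu> + n" "r (Y n) = r \<mu>" for n
    using ini assms(1) by (auto simp: Y_def)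
  have px: "is_prefix (x (0, m)) (x (0, n))" if "m \<le> n" for m n
  proof -
    have z: "0 \<le> m" by (simp add: le_fun_def)
    show ?thesis
      using infpathD(1-4)[OF x z] infpathD(1-4)[OF x that] infpathD(5)[OF x z that]
      unfolding is_prefix_def by metis
  qed
  have pY: "is_prefix (Y m) (Y n)" if "m \<le> n" for m n
    unfolding Y_def using px[OF that] ini assms(1) by (intro is_prefix_comp_mono) auto
  have "\<exists>\<alpha>. is_prefix \<alpha> (Y n) \<and> d \<alpha> = n" for n
    using ex_prefix[OF Y(1), of n n] Y(2) degree_le_add(2) by metis
  then obtain Z where Z: "\<And>n. is_prefix (Z n) (Y n)" "\<And>n. d (Z n) = n" by metis
  have "is_prefix (Z m) (Z n)" if "m \<le> n" for m n
    using is_prefix_mono is_prefix_trans[OF Z(1) pY[OF that]] Z that by metis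
  then obtain z where z: "z \<in> inf_paths \<Lambda>" "\<And>n. z (0, n) = Z n"
    using infpath_from_prefixes[of Z] Z is_prefix_closed(1) by metis
  have zY: "z (0, d \<mu> + n) = Y n" for n
  proof -
    have "is_prefix (Y n) (Y (d \<mu> + n))" by (intro pY degree_le_add)
    then show ?thesis using is_prefix_unique[OF Z(1)] Z(2) Y(2) z(2) by metis
  qed
  have zmu: "z (0, d \<mu>) = \<mu>" using zY[of 0] assms(1) by (simp add: Y_def x0)
  have zI: "z \<in> I (r \<mu>)"
    using z Z(2)[of 0] is_prefix_closed[OF Z(1)[of 0]] Y(3)[of 0] vertexD(3)[OF vertexI] by (simp add: in_I)
  have "shift (d \<mu>) z (0, n) = x (0, n)" for n
  proof -
    have "z (d \<mu>, d \<mu> + n) = x (0, n)"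
      by (rule infpath_segment_unique(2)[OF z(1) degree_le_add(1) assms(1)])
        (use ini zY in \<open>auto simp: Y_def\<close>)
    then show ?thesis by (simp add: shift_def add.commute)
  qed
  then have zs: "shift (d \<mu>) z = x"
    using shift_in_I[OF zI, of "d \<mu>"] x by (intro infpath_eqI) (auto simp: in_I)
  have "concat_inf \<Lambda> \<mu> x = z"
    unfolding concat_inf_def
  proof (rule the_equality)
    fix y assume y: "y \<in> inf_paths \<Lambda> \<and> y (0, d \<mu>) = \<mu> \<and> shift (d \<mu>) y = x"
    have "y (0, d \<mu> + n) = z (0, d \<mu> + n)" for n
    proof -
      have "y (d \<mu>, d \<mu> + n) = x (0, n)" using y by (auto simp: shift_def add.commute)
      then have "y (0, d \<mu> + n) = \<mu> \<bullet> x (0, n)"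
        using infpathD(5)[of y 0 "d \<mu>" "d \<mu> + n"] y degree_le_add by (simp add: le_fun_def)
      then show ?thesis by (simp add: zY Y_def)
    qed
    then show "y = z" using y z(1) degree_le_add(2) by (intro infpath_eqI) auto
  qed (use z zmu zs in auto)
  then show "concat_inf \<Lambda> \<mu> x \<in> I (r \<mu>)" "concat_inf \<Lambda> \<mu> x (0, d \<mu> + n) = \<mu> \<bullet> x (0, n)"
    "concat_inf \<Lambda> \<mu> x (0, d \<mu>) = \<mu>" "shift (d \<mu>) (concat_inf \<Lambda> \<mu> x) = x"
    using zI zY zmu zs by (auto simp: Y_def)
qed

text \<open>Both parts are recovered from the concatenation: the path as its initial segment, the
  tail as its shift.\<close>

lemma concat_inf_cancel:
  assumes "\<mu> \<in> P" "x \<in> I (s \<mu>)" "\<nu> \<in> P" "y \<in> I (s \<nu>)" "d \<mu> = d \<nu>"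
    and "concat_inf \<Lambda> \<mu> x = concat_inf \<Lambda> \<nu> y"
  shows "\<mu> = \<nu>" "x = y"
  using concat_inf_props(3,4) assms by metis+

lemma concat_inf_eqI:
  assumes "z \<in> inf_paths \<Lambda>" "\<mu> \<in> P" "x \<in> I (s \<mu>)" "\<And>n. z (0, d \<mu> + n) = \<mu> \<bullet> x (0, n)"
  shows "z = concat_inf \<Lambda> \<mu> x"
proof (rule infpath_eqI[OF assms(1)])
  show "concat_inf \<Lambda> \<mu> x \<in> inf_paths \<Lambda>"
    using concat_inf_props(1)[OF assms(2,3)] by (simp add: in_I)
  show "\<exists>m\<ge>n. z (0, m) = concat_inf \<Lambda> \<mu> x (0, m)" for n
    using concat_inf_props(2)[OF assms(2,3), of n] assms(4)[of n] degree_le_add(2) by metis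
qed

lemma concat_inf_comp:
  assumes "\<mu> \<in> P" "\<nu> \<in> P" "s \<mu> = r \<nu>" "x \<in> I (s \<nu>)"
  shows "concat_inf \<Lambda> (\<mu> \<bullet> \<nu>) x = concat_inf \<Lambda> \<mu> (concat_inf \<Lambda> \<nu> x)"
proof (rule concat_inf_eqI[symmetric])
  show "x \<in> I (s (\<mu> \<bullet> \<nu>))" "\<mu> \<bullet> \<nu> \<in> P" using assms by auto
  have c: "concat_inf \<Lambda> \<nu> x \<in> I (s \<mu>)" using concat_inf_props assms by metis
  then show "concat_inf \<Lambda> \<mu> (concat_inf \<Lambda> \<nu> x) \<in> inf_paths \<Lambda>"
    using concat_inf_props(1)[OF assms(1)] by (auto simp: in_I)
  show "concat_inf \<Lambda> \<mu> (concat_inf \<Lambda> \<nu> x) (0, d (\<mu> \<bullet> \<nu>) + n) = \<mu> \<bullet> \<nu> \<bullet> x (0, n)" for n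
    using concat_inf_props(2)[OF assms(1) c, of "d \<nu> + n"] concat_inf_props(2)[OF assms(2,4)]
      initial_segment[OF assms(4)] assms
    by (simp add: add.assoc comp_assoc)
qed

end

section \<open>Strong connectivity\<close>

text \<open>Induction on the sum of the coordinates: a nonzero degree has a positive coordinate i,
  and removing one \<open>std_gen i\<close> lowers the sum by one.\<close>

lemma degree_induct [case_names zero add]:
  fixes p :: "'k::finite degree"
  assumes "Q 0" and "\<And>i p. Q p \<Longrightarrow> Q (std_gen i + p)"
  shows "Q p"
proof (induction "\<Sum>i\<in>UNIV. p i" arbitrary: p)
  case 0
  then have "p = 0" by (auto simp: fun_eq_iff)
  then show ?case using assms(1) by metis
next
  case (Suc n)
  then obtain i where i: "p i > 0" by (metis gr0I sum.neutral nat.distinct(1))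
  let ?q = "p(i := p i - 1)"
  have eq: "p = std_gen i + ?q" using i by (auto simp: std_gen_def fun_eq_iff)
  have "(\<Sum>j\<in>UNIV. p j) = (\<Sum>j\<in>UNIV. std_gen i j) + (\<Sum>j\<in>UNIV. ?q j)"
    by (subst eq) (simp add: sum.distrib)
  then have "n = (\<Sum>j\<in>UNIV. ?q j)" using Suc(2) by (simp add: std_gen_def)
  then have "Q (std_gen i + ?q)" using Suc(1) assms(2) by blast
  then show ?case using eq by simp
qed

locale strongly_connected_graph = higher_rank_graph +
  assumes all_colours: "\<And>i. paths_deg \<Lambda> (std_gen i) \<noteq> {}"
    and strongly_connected: "strongly_connected \<Lambda>"
begin

lemma connect:
  assumes "v \<in> vertices \<Lambda>" "w \<in> vertices \<Lambda>"
  obtains \<mu> where "\<mu> \<in> P" "r \<mu> = v" "s \<mu> = w"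
  using strongly_connected assms unfolding strongly_connected_def by blast

lemma no_sources:
  assumes "v \<in> vertices \<Lambda>"
  shows "\<exists>\<mu>\<in>P. r \<mu> = v \<and> d \<mu> = p"
  using assms
proof (induction p arbitrary: v rule: degree_induct)
  case zero
  then show ?case using vertexD by metis
next
  case (add i p)
  obtain e where e: "e \<in> P" "d e = std_gen i" using all_colours[of i] by (auto simp: in_paths_deg)
  obtain \<tau> where \<tau>: "\<tau> \<in> P" "r \<tau> = v" "s \<tau> = r e"
    using connect[of v "r e"] add.prems e(1) by auto
  have "\<tau> \<bullet> e \<in> P" "r (\<tau> \<bullet> e) = v" "d (\<tau> \<bullet> e) = std_gen i + d \<tau>"
    using e \<tau> by (auto simp: add.commute)
  then obtain f where f: "f \<in> P" "r f = v" "d f = std_gen i"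
    using factorise[of "\<tau> \<bullet> e" "std_gen i" "d \<tau>"] by (metis comp_simps(2))
  obtain \<nu> where "\<nu> \<in> P" "r \<nu> = s f" "d \<nu> = p" using add.IH[of "s f"] f(1) by auto
  then have "f \<bullet> \<nu> \<in> P" "r (f \<bullet> \<nu>) = v" "d (f \<bullet> \<nu>) = std_gen i + p" using f by auto
  then show ?case by blast
qed

lemma paths_deg_nonempty: "\<exists>\<mu>. \<mu> \<in> P \<and> d \<mu> = p"
proof -
  \<comment> \<open>Any index will do; the index type is nonempty, which encodes k \<ge> 1.\<close>
  obtain e where "e \<in> P" using all_colours[of undefined] by (auto simp: in_paths_deg)
  then show ?thesis using no_sources[of "r e" p] by auto
qed

text \<open>Paths of degree (1,...,1) are strung together; the partial products \<open>N j\<close>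
  have degree (j,...,j), and these degrees are cofinal.\<close>

lemma infinite_path_exists:
  assumes v: "v \<in> vertices \<Lambda>"
  obtains x where "x \<in> I v"
proof -
  have "\<exists>f. \<forall>w\<in>vertices \<Lambda>. f w \<in> P \<and> r (f w) = w \<and> d (f w) = (\<lambda>_. 1)"
    using no_sources[of _ "\<lambda>_. 1"] by metis
  then obtain f where f: "\<And>w. w \<in> vertices \<Lambda> \<Longrightarrow> f w \<in> P \<and> r (f w) = w \<and> d (f w) = (\<lambda>_. 1)"
    by blast
  define N where "N = rec_nat v (\<lambda>_ \<mu>. \<mu> \<bullet> f (s \<mu>))"
  have N0: "N 0 = v" and NS: "N (Suc j) = N j \<bullet> f (s (N j))" for j by (simp_all add: N_def)
  have N: "N j \<in> P \<and> r (N j) = v \<and> d (N j) = (\<lambda>_. j)" for j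
  proof (induction j)
    case 0
    then show ?case using vertexD[OF v] by (simp add: N0 fun_eq_iff)
  next
    case (Suc j)
    then show ?case using f[of "s (N j)"] by (auto simp: NS fun_eq_iff)
  qed
  have step: "is_prefix (N j) (N (Suc j))" for j
    using N[of j] f[of "s (N j)"] by (auto simp: NS intro!: is_prefix_comp)
  have mono: "is_prefix (N i) (N j)" if "i \<le> j" for i j
    using that
  proof (induction j rule: dec_induct)
    case base
    show ?case using is_prefix_comp[of "N i" "s (N i)"] N[of i] by auto
  next
    case (step j)
    then show ?case using is_prefix_trans \<open>\<And>j. is_prefix (N j) (N (Suc j))\<close> by blast
  qed
  \<comment> \<open>The coordinate sum bounds every coordinate of n, so \<open>N (S n)\<close> has a
    prefix of degree n. It is monotone in n, which makes the chosen prefixes coherent.\<close>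
  define S where "S n = (\<Sum>i\<in>UNIV. n i)" for n :: "'a degree"
  have "\<exists>\<alpha>. is_prefix \<alpha> (N (S n)) \<and> d \<alpha> = n" for n
  proof -
    have "n \<le> d (N (S n))"
      using N[of "S n"] by (auto simp: S_def le_fun_def intro: member_le_sum)
    then show ?thesis using ex_prefix[of "N (S n)" n] N by metis
  qed
  then obtain X where X: "\<And>n. is_prefix (X n) (N (S n))" "\<And>n. d (X n) = n" by metis
  have "is_prefix (X m) (X n)" if "m \<le> n" for m n
  proof -
    have "S m \<le> S n" using that by (auto simp: S_def le_fun_def intro: sum_mono)
    then show ?thesis using is_prefix_mono is_prefix_trans[OF X(1) mono] X that by metis
  qed
  then obtain x where x: "x \<in> inf_paths \<Lambda>" "\<And>n. x (0, n) = X n"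
    using infpath_from_prefixes[of X] X is_prefix_closed(1) by metis
  have "X 0 \<in> vertices \<Lambda>" using X is_prefix_closed by (intro vertexI) blast+
  then have "X 0 = v" using vertexD(3) is_prefix_closed(3)[OF X(1)[of 0]] N by metis
  then show ?thesis using that x by (auto simp: in_I)
qed

end

section \<open>Self-similar actions\<close>

locale self_similar_graph = higher_rank_graph \<Lambda> for \<Lambda> :: "('k::finite, 'l) kgraph" +
  fixes G :: "('l, 'g) groupoid" and \<phi> :: "'g \<Rightarrow> 'l piso"
  assumes self_similar: "self_similar_action \<Lambda> G \<phi>"
begin

abbreviation arrs where "arrs \<equiv> arrows G"
abbreviation dm where "dm \<equiv> gdom G"
abbreviation cd where "cd \<equiv> gcod G"
abbreviation iv where "iv \<equiv> ginv G"
abbreviation un where "un \<equiv> unit_arr G"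
abbreviation gm (infixl "\<star>" 70) where "g \<star> h \<equiv> gmult G g h"
abbreviation ac (infixr "\<rhd>" 75) where "g \<rhd> \<mu> \<equiv> act \<phi> g \<mu>"
abbreviation rs where "rs \<equiv> restr \<Lambda> G \<phi>"
abbreviation is_restr where "is_restr \<equiv> is_restriction \<Lambda> G \<phi>"

lemma groupoid_G: "groupoid G" and units_G: "units G = vertices \<Lambda>"
  and hom_phi: "groupoid_hom G (PIso \<Lambda>) \<phi>" and inj_phi: "inj_on \<phi> arrs"
  using self_similar by (auto simp: self_similar_action_def faithful_action_def groupoid_action_def)

lemma arrow_simps [simp]:
  assumes "g \<in> arrs"
  shows "dm g \<in> vertices \<Lambda>" "cd g \<in> vertices \<Lambda>" "g \<star> un (dm g) = g" "un (cd g) \<star> g = g"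
    "iv g \<in> arrs" "dm (iv g) = cd g" "cd (iv g) = dm g"
    "iv g \<star> g = un (dm g)" "g \<star> iv g = un (cd g)"
  using groupoid_G units_G assms unfolding groupoid_def by blast+

lemma unit_simps [simp]:
  assumes "v \<in> vertices \<Lambda>"
  shows "un v \<in> arrs" "dm (un v) = v" "cd (un v) = v"
  using groupoid_G units_G assms unfolding groupoid_def by blast+

lemma gmult_simps [simp]:
  assumes "g \<in> arrs" "h \<in> arrs" "dm g = cd h"
  shows "g \<star> h \<in> arrs" "dm (g \<star> h) = dm h" "cd (g \<star> h) = cd g"
  using groupoid_G assms unfolding groupoid_def by blast+

lemma gmult_assoc:
  assumes "f \<in> arrs" "g \<in> arrs" "h \<in> arrs" "dm f = cd g" "dm g = cd h"
  shows "f \<star> g \<star> h = f \<star> (g \<star> h)"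
  using groupoid_G assms unfolding groupoid_def by blast

section \<open>The action on finite paths\<close>

lemma phi_eq:
  assumes "g \<in> arrs"
  shows "\<phi> g = (dm g, cd g, act \<phi> g)"
proof -
  have "gdom (PIso \<Lambda>) (\<phi> g) = dm g" "gcod (PIso \<Lambda>) (\<phi> g) = cd g"
    using hom_phi assms by (auto simp: groupoid_hom_def)
  then show ?thesis by (auto simp: PIso_def act_def fun_eq_iff split: prod.splits)
qed

lemma partial_iso_act:
  assumes "g \<in> arrs"
  shows "partial_iso \<Lambda> (dm g, cd g, act \<phi> g)"
proof -
  have "\<phi> g \<in> arrows (PIso \<Lambda>)" using hom_phi assms by (auto simp: groupoid_hom_def)
  then show ?thesis by (simp add: PIso_def phi_eq[OF assms, symmetric])
qed

lemma act_simps [simp]: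
  assumes "g \<in> arrs" "\<mu> \<in> P" "r \<mu> = dm g"
  shows "g \<rhd> \<mu> \<in> P" "r (g \<rhd> \<mu>) = cd g" "d (g \<rhd> \<mu>) = d \<mu>"
proof -
  have "act \<phi> g ` (paths_from \<Lambda> (dm g) \<inter> paths_deg \<Lambda> (d \<mu>)) = paths_from \<Lambda> (cd g) \<inter> paths_deg \<Lambda> (d \<mu>)"
    using partial_iso_act[OF assms(1)] by (auto simp: partial_iso_def)
  then have "g \<rhd> \<mu> \<in> paths_from \<Lambda> (cd g) \<inter> paths_deg \<Lambda> (d \<mu>)"
    using assms(2,3) by (auto simp: in_paths_from in_paths_deg)
  then show "g \<rhd> \<mu> \<in> P" "r (g \<rhd> \<mu>) = cd g" "d (g \<rhd> \<mu>) = d \<mu>"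
    by (auto simp: in_paths_from in_paths_deg)
qed

text \<open>The image has degree 0, so it is a vertex, and a vertex equals its own range.\<close>

lemma act_dom [simp]: "g \<in> arrs \<Longrightarrow> g \<rhd> dm g = cd g"
  using act_simps[of g "dm g"] vertexD[of "dm g"] vertexD(3)[OF vertexI, of "g \<rhd> dm g"] by simp

lemma act_mult:
  assumes "g \<in> arrs" "h \<in> arrs" "dm g = cd h" "\<mu> \<in> P" "r \<mu> = dm h"
  shows "(g \<star> h) \<rhd> \<mu> = g \<rhd> h \<rhd> \<mu>"
proof -
  have "\<phi> (g \<star> h) = gmult (PIso \<Lambda>) (\<phi> g) (\<phi> h)"
    using hom_phi assms by (auto simp: groupoid_hom_def)
  then have "act \<phi> (g \<star> h) = compose (paths_from \<Lambda> (dm h)) (act \<phi> g) (act \<phi> h)"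
    using assms by (simp add: phi_eq PIso_def)
  then show ?thesis using assms by (simp add: compose_def in_paths_from)
qed

lemma act_unit:
  assumes "v \<in> vertices \<Lambda>" "\<mu> \<in> P" "r \<mu> = v"
  shows "un v \<rhd> \<mu> = \<mu>"
proof -
  have "\<phi> (un v) = unit_arr (PIso \<Lambda>) v"
    using hom_phi assms by (auto simp: groupoid_hom_def units_G)
  then show ?thesis using assms by (simp add: act_def PIso_def in_paths_from)
qed

lemma act_inv:
  assumes "g \<in> arrs" "\<mu> \<in> P"
  shows "r \<mu> = dm g \<Longrightarrow> iv g \<rhd> g \<rhd> \<mu> = \<mu>" "r \<mu> = cd g \<Longrightarrow> g \<rhd> iv g \<rhd> \<mu> = \<mu>"
  using act_mult[of "iv g" g \<mu>] act_mult[of g "iv g" \<mu>] act_unit assms by auto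

text \<open>Faithfulness in pointwise form. The codomain is read off from the image of the domain
  vertex, and extensionality turns agreement on paths into equality of maps.\<close>

lemma arrow_eqI:
  assumes "g \<in> arrs" "h \<in> arrs" "dm g = dm h"
    and "\<And>\<mu>. \<mu> \<in> P \<Longrightarrow> r \<mu> = dm g \<Longrightarrow> g \<rhd> \<mu> = h \<rhd> \<mu>"
  shows "g = h"
proof -
  have "cd g = cd h" using assms act_dom vertexD by (metis arrow_simps(1))
  moreover have "act \<phi> g = act \<phi> h"
  proof (rule extensionalityI)
    show "act \<phi> g \<in> extensional (paths_from \<Lambda> (dm g))" "act \<phi> h \<in> extensional (paths_from \<Lambda> (dm g))"
      using partial_iso_act[OF assms(1)] partial_iso_act[OF assms(2)] assms(3)
      by (auto simp: partial_iso_def)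
  qed (use assms in \<open>auto simp: in_paths_from\<close>)
  ultimately have "\<phi> g = \<phi> h" using phi_eq assms by metis
  then show ?thesis using inj_phi assms by (auto dest: inj_onD)
qed

text \<open>From here on the predicate is applied to arbitrary paths \<mu>, not just edges, so that
  \<open>restr\<close> can be characterised by an equation instead of by a chosen
  factorisation.\<close>

lemma is_restr_iff:
  "is_restr g \<mu> h \<longleftrightarrow> h \<in> arrs \<and> dm h = s \<mu> \<and> cd h = s (g \<rhd> \<mu>) \<and>
    (\<forall>\<nu>\<in>P. r \<nu> = s \<mu> \<longrightarrow> g \<rhd> (\<mu> \<bullet> \<nu>) = (g \<rhd> \<mu>) \<bullet> (h \<rhd> \<nu>))"
  by (auto simp: is_restriction_def in_paths_from)

text \<open>Cancel \<open>g \<rhd> \<mu>\<close> on the left; the two arrows then act alike, and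
  faithfulness applies.\<close>

lemma is_restr_unique:
  assumes g: "g \<in> arrs" "\<mu> \<in> P" "r \<mu> = dm g" and h: "is_restr g \<mu> h" "is_restr g \<mu> h'"
  shows "h = h'"
proof (rule arrow_eqI)
  fix \<nu> assume \<nu>: "\<nu> \<in> P" "r \<nu> = dm h"
  show "h \<rhd> \<nu> = h' \<rhd> \<nu>"
  proof (rule comp_cancel(2))
    show "(g \<rhd> \<mu>) \<bullet> (h \<rhd> \<nu>) = (g \<rhd> \<mu>) \<bullet> (h' \<rhd> \<nu>)"
      using h \<nu> unfolding is_restr_iff by metis
  qed (use g h \<nu> in \<open>auto simp: is_restr_iff\<close>)
qed (use h in \<open>auto simp: is_restr_iff\<close>)

lemma is_restr_comp:
  assumes g: "g \<in> arrs" "\<mu> \<in> P" "r \<mu> = dm g" and \<nu>: "\<nu> \<in> P" "r \<nu> = s \<mu>"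
    and h: "is_restr g \<mu> h" and k: "is_restr h \<nu> k"
  shows "is_restr g (\<mu> \<bullet> \<nu>) k"
  unfolding is_restr_iff
proof (intro conjI ballI impI)
  have e: "g \<rhd> (\<mu> \<bullet> \<nu>) = (g \<rhd> \<mu>) \<bullet> (h \<rhd> \<nu>)" using h \<nu> by (simp add: is_restr_iff)
  have hs: "h \<in> arrs" "dm h = s \<mu>" "cd h = s (g \<rhd> \<mu>)" and ks: "k \<in> arrs" "dm k = s \<nu>" "cd k = s (h \<rhd> \<nu>)"
    using h k by (auto simp: is_restr_iff)
  show "k \<in> arrs" by fact
  show "dm k = s (\<mu> \<bullet> \<nu>)" using g \<nu> ks by simp
  show "cd k = s (g \<rhd> (\<mu> \<bullet> \<nu>))" using e g \<nu> ks hs by simp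
  fix \<rho> assume \<rho>: "\<rho> \<in> P" "r \<rho> = s (\<mu> \<bullet> \<nu>)"
  then have r: "r \<rho> = s \<nu>" using g \<nu> by simp
  have "g \<rhd> (\<mu> \<bullet> \<nu> \<bullet> \<rho>) = g \<rhd> (\<mu> \<bullet> (\<nu> \<bullet> \<rho>))"
    using \<rho> r \<nu> g by (simp add: comp_assoc)
  also have "\<dots> = (g \<rhd> \<mu>) \<bullet> (h \<rhd> (\<nu> \<bullet> \<rho>))" using h \<nu> \<rho> r by (simp add: is_restr_iff)
  also have "h \<rhd> (\<nu> \<bullet> \<rho>) = (h \<rhd> \<nu>) \<bullet> (k \<rhd> \<rho>)" using k \<rho> r by (simp add: is_restr_iff)
  also have "(g \<rhd> \<mu>) \<bullet> ((h \<rhd> \<nu>) \<bullet> (k \<rhd> \<rho>)) = (g \<rhd> \<mu>) \<bullet> (h \<rhd> \<nu>) \<bullet> (k \<rhd> \<rho>)"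
    using g hs ks \<nu> \<rho> r by (intro comp_assoc[symmetric]) auto
  finally show "g \<rhd> (\<mu> \<bullet> \<nu> \<bullet> \<rho>) = (g \<rhd> (\<mu> \<bullet> \<nu>)) \<bullet> (k \<rhd> \<rho>)" using e by simp
qed

lemma edge_in_paths: "e \<in> edges \<Lambda> \<Longrightarrow> e \<in> P"
  by (auto simp: edges_def in_paths_deg)

lemma is_restr_restr_edge:
  assumes "g \<in> arrs" "e \<in> edges \<Lambda>" "r e = dm g"
  shows "is_restr g e (restr_edge \<Lambda> G \<phi> g e)"
proof -
  have "\<exists>h. is_restr g e h"
    using self_similar assms edge_in_paths by (auto simp: self_similar_action_def in_paths_from)
  then show ?thesis
    unfolding restr_edge_def using is_restr_unique assms edge_in_paths by (metis theI)
qed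

lemma is_restr_vertex: "g \<in> arrs \<Longrightarrow> is_restr g (dm g) g"
  using vertexD[of "dm g"] vertexD[of "cd g"] act_simps path_simps(7)
  by (auto simp: is_restr_iff) (metis act_simps(1,2) path_simps(7))

text \<open>Every edge factorisation folds to an arrow with the characterising property; together
  with uniqueness this makes \<open>restr\<close> independent of the chosen list.\<close>

lemma is_restr_foldl:
  assumes "edge_factorisation \<Lambda> \<mu> es" "g \<in> arrs" "r \<mu> = dm g"
  shows "is_restr g \<mu> (foldl (restr_edge \<Lambda> G \<phi>) g es)"
  using assms
proof (induction es arbitrary: g \<mu>)
  case Nil
  then show ?case using is_restr_vertex[of g] vertexD[of \<mu>] by simp
next
  case (Cons e es)
  then obtain \<nu> where \<nu>: "e \<in> edges \<Lambda>" "\<nu> \<in> P" "r \<nu> = s e" "\<mu> = e \<bullet> \<nu>" "edge_factorisation \<Lambda> \<nu> es"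
    by (auto simp: in_paths_from)
  have e: "e \<in> P" "r e = dm g" using \<nu> Cons.prems edge_in_paths by auto
  let ?h = "restr_edge \<Lambda> G \<phi> g e"
  have h: "is_restr g e ?h" using is_restr_restr_edge Cons.prems \<nu> e by blast
  then have "is_restr ?h \<nu> (foldl (restr_edge \<Lambda> G \<phi>) ?h es)"
    using Cons.IH[OF \<nu>(5), of ?h] \<nu> by (simp add: is_restr_iff)
  then show ?case using is_restr_comp[OF Cons.prems(2) e \<nu>(2,3) h] \<nu> by simp
qed

lemma edge_factorisation_exists:
  assumes "\<mu> \<in> P"
  shows "\<exists>es. edge_factorisation \<Lambda> \<mu> es"
  using assms
proof (induction "d \<mu>" arbitrary: \<mu> rule: degree_induct)
  case zero
  then have "edge_factorisation \<Lambda> \<mu> []" using vertexI by (metis edge_factorisation.simps(1))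
  then show ?case by blast
next
  case (add i p)
  then obtain e \<nu> where e: "e \<in> P" "\<nu> \<in> P" "s e = r \<nu>" "\<mu> = e \<bullet> \<nu>" "d e = std_gen i" "d \<nu> = p"
    using factorise by metis
  then obtain es where "edge_factorisation \<Lambda> \<nu> es" using add by metis
  then have "edge_factorisation \<Lambda> \<mu> (e # es)"
    using e by (auto simp: edges_def in_paths_deg in_paths_from)
  then show ?case by blast
qed

lemma is_restr_restr:
  assumes "g \<in> arrs" "\<mu> \<in> P" "r \<mu> = dm g"
  shows "is_restr g \<mu> (rs g \<mu>)"
  unfolding restr_def
  using is_restr_foldl someI_ex[OF edge_factorisation_exists] assms by blast

lemma restr_simps [simp]:
  assumes "g \<in> arrs" "\<mu> \<in> P" "r \<mu> = dm g"
  shows "rs g \<mu> \<in> arrs" "dm (rs g \<mu>) = s \<mu>" "cd (rs g \<mu>) = s (g \<rhd> \<mu>)"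
  using is_restr_restr[OF assms] by (auto simp: is_restr_iff)

lemma act_comp:
  assumes "g \<in> arrs" "\<mu> \<in> P" "r \<mu> = dm g" "\<nu> \<in> P" "r \<nu> = s \<mu>"
  shows "g \<rhd> (\<mu> \<bullet> \<nu>) = (g \<rhd> \<mu>) \<bullet> (rs g \<mu> \<rhd> \<nu>)"
  using is_restr_restr[of g \<mu>] assms by (auto simp: is_restr_iff)

lemma restr_eqI:
  assumes "g \<in> arrs" "\<mu> \<in> P" "r \<mu> = dm g" "is_restr g \<mu> h"
  shows "rs g \<mu> = h"
  using is_restr_restr is_restr_unique assms by blast

lemma restr_dom [simp]: "g \<in> arrs \<Longrightarrow> rs g (dm g) = g"
  using is_restr_vertex vertexD[of "dm g"] by (intro restr_eqI) auto

lemma restr_comp: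
  assumes "g \<in> arrs" "\<mu> \<in> P" "r \<mu> = dm g" "\<nu> \<in> P" "r \<nu> = s \<mu>"
  shows "rs g (\<mu> \<bullet> \<nu>) = rs (rs g \<mu>) \<nu>"
  using assms by (intro restr_eqI is_restr_comp[OF _ _ _ _ _ is_restr_restr is_restr_restr]) auto

section \<open>The action on infinite paths\<close>

abbreviation ia where "ia \<equiv> act_inf \<Lambda> G \<phi>"

text \<open>That \<open>ia g x\<close> is a functor amounts to the cocycle identity
  \<open>restr_comp\<close> along x. The formula for initial segments is the case p = 0, where the
  restriction is g itself; later identities are checked on these segments only.\<close>

lemma act_inf_props:
  assumes g: "g \<in> arrs" and x: "x \<in> I (dm g)"
  shows "ia g x \<in> I (cd g)" "ia g x (0, n) = g \<rhd> x (0, n)"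
proof -
  note ini = initial_segment[OF x]
  have xi: "x \<in> inf_paths \<Lambda>" "x (0, 0) = dm g" using x by (auto simp: in_I)
  have z: "0 \<le> p" for p :: "'k degree" by (simp add: le_fun_def)
  have ia: "ia g x (p, q) = rs g (x (0, p)) \<rhd> x (p, q)" if "p \<le> q" for p q
    using that by (simp add: act_inf_def)
  have src: "s (x (0, p)) = x (p, p)" for p using infpathD(4)[OF xi(1) z] .
  have R: "rs g (x (0, p)) \<in> arrs" "dm (rs g (x (0, p))) = x (p, p)" for p
    using g ini src by auto
  have iapp: "ia g x (p, p) = cd (rs g (x (0, p)))" for p
    using ia[of p p] act_dom[OF R(1)[of p]] R(2)[of p] by simp
  \<comment> \<open>The cocycle identity along x; it also matches the source of one image segment
    with the start of the next.\<close>
  have step: "rs g (x (0, q)) = rs (rs g (x (0, p))) (x (p, q))"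
    and src_step: "s (rs g (x (0, p)) \<rhd> x (p, q)) = ia g x (q, q)" if pq: "p \<le> q" for p q
  proof -
    have xpq: "x (p, q) \<in> P" "r (x (p, q)) = x (p, p)" "s (x (p, q)) = x (q, q)"
      using infpathD(1,3,4)[OF xi(1) pq] by auto
    show step: "rs g (x (0, q)) = rs (rs g (x (0, p))) (x (p, q))"
      using restr_comp[of g "x (0, p)" "x (p, q)"] infpathD(5)[OF xi(1) z pq] g ini src xpq by simp
    show "s (rs g (x (0, p)) \<rhd> x (p, q)) = ia g x (q, q)"
      using restr_simps(3)[OF R(1)[of p], of "x (p, q)"] R[of p] xpq by (simp add: iapp step)
  qed
  have "ia g x \<in> inf_paths \<Lambda>"
    unfolding inf_paths_def
  proof (intro CollectI conjI allI impI; (elim conjE)?)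
    show "ia g x \<in> extensional {(p, q). p \<le> q}" by (auto simp: act_inf_def extensional_def)
  next
    fix p q :: "'k degree" assume pq: "p \<le> q"
    have xpq: "x (p, q) \<in> P" "r (x (p, q)) = dm (rs g (x (0, p)))" "d (x (p, q)) = q - p"
      using infpathD(1-3)[OF xi(1) pq] R(2) by auto
    show "ia g x (p, q) \<in> P" "d (ia g x (p, q)) = q - p" "r (ia g x (p, q)) = ia g x (p, p)"
      using act_simps[OF R(1) xpq(1,2)] xpq(3) by (auto simp: ia[OF pq] iapp)
    show "s (ia g x (p, q)) = ia g x (q, q)" using src_step[OF pq] by (simp add: ia[OF pq])
  next
    fix p q n :: "'k degree" assume pq: "p \<le> q" and qn: "q \<le> n"
    have pn: "p \<le> n" using pq qn by simp
    show "ia g x (p, n) = ia g x (p, q) \<bullet> ia g x (q, n)"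
      using act_comp[OF R(1)[of p], of "x (p, q)" "x (q, n)"] infpathD(1,3,4)[OF xi(1) pq]
        infpathD(1,3,4)[OF xi(1) qn] infpathD(5)[OF xi(1) pq qn] R(2)[of p]
      by (simp add: ia[OF pq] ia[OF pn] ia[OF qn] step[OF pq])
  qed
  then show "ia g x \<in> I (cd g)" using iapp[of 0] g xi by (simp add: in_I)
  show "ia g x (0, n) = g \<rhd> x (0, n)" using ia[OF z, of n] g xi by simp
qed

lemma act_inf_concat:
  assumes "g \<in> arrs" "\<mu> \<in> P" "r \<mu> = dm g" "x \<in> I (s \<mu>)"
  shows "ia g (concat_inf \<Lambda> \<mu> x) = concat_inf \<Lambda> (g \<rhd> \<mu>) (ia (rs g \<mu>) x)"
proof (rule concat_inf_eqI)
  have c: "concat_inf \<Lambda> \<mu> x \<in> I (dm g)" using concat_inf_props(1)[OF assms(2,4)] assms(3) by simp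
  have x: "x \<in> I (dm (rs g \<mu>))" using assms by simp
  show "ia g (concat_inf \<Lambda> \<mu> x) \<in> inf_paths \<Lambda>"
    using act_inf_props(1)[OF assms(1) c] by (simp add: in_I)
  show "ia (rs g \<mu>) x \<in> I (s (g \<rhd> \<mu>))" using act_inf_props(1)[OF _ x] assms by simp
  show "ia g (concat_inf \<Lambda> \<mu> x) (0, d (g \<rhd> \<mu>) + n) = (g \<rhd> \<mu>) \<bullet> ia (rs g \<mu>) x (0, n)" for n
    using act_inf_props(2)[OF assms(1) c] act_inf_props(2)[OF _ x] assms
      concat_inf_props(2)[OF assms(2,4)] act_comp initial_segment[OF assms(4)] by simp
qed (use assms in auto)

lemma act_inf_mult:
  assumes "g \<in> arrs" "h \<in> arrs" "dm g = cd h" "x \<in> I (dm h)"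
  shows "ia (g \<star> h) x = ia g (ia h x)"
proof (rule infpath_eqI)
  have hx: "ia h x \<in> I (dm g)" using act_inf_props(1) assms by simp
  have x: "x \<in> I (dm (g \<star> h))" using assms by simp
  show "ia (g \<star> h) x \<in> inf_paths \<Lambda>" "ia g (ia h x) \<in> inf_paths \<Lambda>"
    using act_inf_props(1)[OF _ x] act_inf_props(1)[OF _ hx] assms by (auto simp: in_I)
  have "ia (g \<star> h) x (0, n) = ia g (ia h x) (0, n)" for n
    using act_inf_props(2)[OF _ x] act_inf_props(2)[OF _ hx] act_inf_props(2)[OF _ assms(4)]
      act_mult initial_segment[OF assms(4)] assms by simp
  then show "\<exists>m\<ge>n. ia (g \<star> h) x (0, m) = ia g (ia h x) (0, m)" for n by blast
qed

lemma act_inf_unit: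
  assumes "v \<in> vertices \<Lambda>" "x \<in> I v"
  shows "ia (un v) x = x"
proof (rule infpath_eqI)
  have x: "x \<in> I (dm (un v))" using assms by simp
  show "ia (un v) x \<in> inf_paths \<Lambda>" "x \<in> inf_paths \<Lambda>"
    using act_inf_props(1)[OF _ x] assms by (auto simp: in_I)
  have "ia (un v) x (0, n) = x (0, n)" for n
    using act_inf_props(2)[OF _ x] act_unit initial_segment[OF assms(2)] assms by simp
  then show "\<exists>m\<ge>n. ia (un v) x (0, m) = x (0, m)" for n by blast
qed

lemma act_inf_inv:
  assumes "g \<in> arrs"
  shows "x \<in> I (dm g) \<Longrightarrow> ia (iv g) (ia g x) = x" "x \<in> I (cd g) \<Longrightarrow> ia g (ia (iv g) x) = x"
  using act_inf_mult[of "iv g" g x] act_inf_mult[of g "iv g" x] act_inf_unit assms by auto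

end

section \<open>Cycline triples and the periodicity group\<close>

locale periodic_graph =
  self_similar_graph \<Lambda> G \<phi> + strongly_connected_graph \<Lambda>
  for \<Lambda> :: "('k::finite, 'l) kgraph" and G :: "('l, 'g) groupoid" and \<phi> :: "'g \<Rightarrow> 'l piso"
begin

text \<open>Every finite path \<mu> extends to an infinite one \<mu>y, and the image of \<mu>y
  begins with the image of \<mu>.\<close>

lemma faithful_on_infinite_paths:
  assumes "g \<in> arrs" "h \<in> arrs" "dm g = dm h" and eq: "\<And>x. x \<in> I (dm g) \<Longrightarrow> ia g x = ia h x"
  shows "g = h"
proof (rule arrow_eqI[OF assms(1-3)])
  fix \<mu> assume \<mu>: "\<mu> \<in> P" "r \<mu> = dm g"
  obtain y where y: "y \<in> I (s \<mu>)" using infinite_path_exists[of "s \<mu>"] \<mu> by auto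
  note c = concat_inf_props[OF \<mu>(1) y]
  have x: "concat_inf \<Lambda> \<mu> y \<in> I (dm g)" using c(1) \<mu>(2) by simp
  then have "ia g (concat_inf \<Lambda> \<mu> y) (0, d \<mu>) = ia h (concat_inf \<Lambda> \<mu> y) (0, d \<mu>)"
    using eq by simp
  then show "g \<rhd> \<mu> = h \<rhd> \<mu>"
    using act_inf_props(2)[OF assms(1) x] act_inf_props(2)[of h, OF assms(2)] assms(3) x c(3) by metis
qed

text \<open>The condition inside \<open>theta_h\<close>, with the degrees left free so that triples
  of different degrees can be extended and composed.\<close>

definition cycline :: "'l \<Rightarrow> 'g \<Rightarrow> 'l \<Rightarrow> bool" where
  "cycline \<mu> h \<nu> \<longleftrightarrow> \<mu> \<in> P \<and> \<nu> \<in> P \<and> h \<in> arrs \<and> cd h = s \<mu> \<and> dm h = s \<nu> \<and>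
    (\<forall>x\<in>I (s \<nu>). concat_inf \<Lambda> \<mu> (ia h x) = concat_inf \<Lambda> \<nu> x)"

lemma cyclineD:
  assumes "cycline \<mu> h \<nu>"
  shows "\<mu> \<in> P" "\<nu> \<in> P" "h \<in> arrs" "cd h = s \<mu>" "dm h = s \<nu>"
    "x \<in> I (s \<nu>) \<Longrightarrow> concat_inf \<Lambda> \<mu> (ia h x) = concat_inf \<Lambda> \<nu> x"
    "x \<in> I (s \<nu>) \<Longrightarrow> ia h x \<in> I (s \<mu>)"
  using assms act_inf_props(1)[of h x] by (auto simp: cycline_def)

text \<open>One infinite path x from \<open>s \<nu>\<close> suffices: \<mu>(h x) and \<nu>x are the
  same infinite path and start at the respective ranges.\<close>

lemma cycline_rng:
  assumes "cycline \<mu> h \<nu>"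
  shows "r \<mu> = r \<nu>"
proof -
  note c = cyclineD[OF assms]
  obtain x where x: "x \<in> I (s \<nu>)" using infinite_path_exists[of "s \<nu>"] c(2) by auto
  show ?thesis
    using concat_inf_props(1)[OF c(2) x] concat_inf_props(1)[OF c(1) c(7)[OF x]] c(6)[OF x]
    by (simp add: in_I)
qed

section \<open>Closure properties of cycline triples\<close>

lemma cycline_unit: "\<nu> \<in> P \<Longrightarrow> cycline \<nu> (un (s \<nu>)) \<nu>"
  by (auto simp: cycline_def act_inf_unit)

lemma cycline_inv:
  assumes "cycline \<mu> h \<nu>"
  shows "cycline \<nu> (iv h) \<mu>"
proof -
  note c = cyclineD[OF assms]
  have "concat_inf \<Lambda> \<nu> (ia (iv h) x) = concat_inf \<Lambda> \<mu> x" if "x \<in> I (s \<mu>)" for x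
    using c(6)[of "ia (iv h) x"] act_inf_inv(2)[OF c(3), of x] act_inf_props(1)[of "iv h" x] c that
    by simp
  then show ?thesis using c by (simp add: cycline_def)
qed

lemma cycline_mult:
  assumes "cycline \<mu> g \<nu>" "cycline \<nu> h \<rho>"
  shows "cycline \<mu> (g \<star> h) \<rho>"
proof -
  note c = cyclineD[OF assms(1)] and e = cyclineD[OF assms(2)]
  have "concat_inf \<Lambda> \<mu> (ia (g \<star> h) x) = concat_inf \<Lambda> \<rho> x" if "x \<in> I (s \<rho>)" for x
    using act_inf_mult[of g h x] c(6)[of "ia h x"] e(6,7)[OF that] c e that by simp
  then show ?thesis using c e by (simp add: cycline_def)
qed

lemma cycline_prepend:
  assumes "cycline \<mu> h \<nu>" "\<kappa> \<in> P" "s \<kappa> = r \<mu>"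
  shows "cycline (\<kappa> \<bullet> \<mu>) h (\<kappa> \<bullet> \<nu>)"
proof -
  note c = cyclineD[OF assms(1)]
  have "concat_inf \<Lambda> (\<kappa> \<bullet> \<mu>) (ia h x) = concat_inf \<Lambda> (\<kappa> \<bullet> \<nu>) x" if "x \<in> I (s \<nu>)" for x
    using concat_inf_comp[OF assms(2) c(1) assms(3) c(7)[OF that]] concat_inf_comp[OF assms(2) c(2) _ that]
      c(6)[OF that] cycline_rng[OF assms(1)] assms(3) by simp
  then show ?thesis using c assms(2,3) cycline_rng[OF assms(1)] by (simp add: cycline_def)
qed

text \<open>Self-similarity gives \<mu>(h \<rhd> \<rho>)(h|_\<rho> x) = \<mu>(h(\<rho>x)) =
  \<nu>\<rho>x.\<close>

lemma cycline_append:
  assumes "cycline \<mu> h \<nu>" "\<rho> \<in> P" "r \<rho> = s \<nu>"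
  shows "cycline (\<mu> \<bullet> (h \<rhd> \<rho>)) (rs h \<rho>) (\<nu> \<bullet> \<rho>)"
proof -
  note c = cyclineD[OF assms(1)]
  have "concat_inf \<Lambda> (\<mu> \<bullet> (h \<rhd> \<rho>)) (ia (rs h \<rho>) x) = concat_inf \<Lambda> (\<nu> \<bullet> \<rho>) x"
    if x: "x \<in> I (s \<rho>)" for x
  proof -
    have k: "ia (rs h \<rho>) x \<in> I (s (h \<rhd> \<rho>))"
      using act_inf_props(1)[of "rs h \<rho>" x] c assms x by simp
    have \<rho>x: "concat_inf \<Lambda> \<rho> x \<in> I (s \<nu>)" using concat_inf_props(1)[OF assms(2) x] assms(3) by simp
    have "concat_inf \<Lambda> (\<mu> \<bullet> (h \<rhd> \<rho>)) (ia (rs h \<rho>) x) = concat_inf \<Lambda> \<mu> (ia h (concat_inf \<Lambda> \<rho> x))"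
      using concat_inf_comp[OF c(1) _ _ k] act_inf_concat[OF c(3) assms(2) _ x] c assms by simp
    also have "\<dots> = concat_inf \<Lambda> (\<nu> \<bullet> \<rho>) x"
      using c(6)[OF \<rho>x] concat_inf_comp[OF c(2) assms(2) _ x] assms(3) by simp
    finally show ?thesis .
  qed
  then show ?thesis using c assms by (simp add: cycline_def)
qed

text \<open>Apply g to \<mu>(h y) = \<nu>y. The right side becomes (g \<rhd> \<nu>)x with x =
  g|_\<nu> y, the left side (g \<rhd> \<mu>)(g|_\<mu> h y); substituting y = (g|_\<nu>)^-1 x yields
  the middle arrow.\<close>

lemma cycline_act:
  assumes "cycline \<mu> h \<nu>" "g \<in> arrs" "dm g = r \<mu>"
  shows "cycline (g \<rhd> \<mu>) (rs g \<mu> \<star> h \<star> iv (rs g \<nu>)) (g \<rhd> \<nu>)"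
proof -
  note c = cyclineD[OF assms(1)]
  have \<nu>: "r \<nu> = dm g" and \<mu>: "r \<mu> = dm g" using cycline_rng[OF assms(1)] assms by auto
  let ?k = "rs g \<mu> \<star> h \<star> iv (rs g \<nu>)"
  have k: "rs g \<mu> \<in> arrs" "rs g \<nu> \<in> arrs" "dm (rs g \<mu>) = cd h" "cd (iv (rs g \<nu>)) = dm h"
    "rs g \<mu> \<star> h \<in> arrs" "dm (rs g \<mu> \<star> h) = dm h"
    using c assms \<nu> \<mu> by simp_all
  have "concat_inf \<Lambda> (g \<rhd> \<mu>) (ia ?k x) = concat_inf \<Lambda> (g \<rhd> \<nu>) x" if x: "x \<in> I (s (g \<rhd> \<nu>))" for x
  proof -
    define y where "y = ia (iv (rs g \<nu>)) x"
    have y: "y \<in> I (s \<nu>)" "ia (rs g \<nu>) y = x"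
      using act_inf_props(1)[of "iv (rs g \<nu>)" x] act_inf_inv(2)[of "rs g \<nu>" x] k x c \<nu> assms
      by (auto simp: y_def)
    have "ia ?k x = ia (rs g \<mu>) (ia h y)"
      using act_inf_mult[of "rs g \<mu> \<star> h" "iv (rs g \<nu>)" x] act_inf_mult[of "rs g \<mu>" h y] k x c y \<nu> assms
      by (simp add: y_def)
    then have "concat_inf \<Lambda> (g \<rhd> \<mu>) (ia ?k x) = ia g (concat_inf \<Lambda> \<mu> (ia h y))"
      using act_inf_concat[OF assms(2) c(1) \<mu> c(7)[OF y(1)]] by simp
    also have "\<dots> = concat_inf \<Lambda> (g \<rhd> \<nu>) x"
      using act_inf_concat[OF assms(2) c(2) \<nu> y(1)] c(6)[OF y(1)] y(2) by simp
    finally show ?thesis .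
  qed
  then show ?thesis using c assms \<nu> \<mu> by (simp add: cycline_def)
qed

text \<open>For y from \<open>s \<mu>\<close> the inverse triples show that both \<nu> and \<nu>'
  are initial segments of \<mu>y, and their degrees agree. Cancelling \<mu> then gives h x = h' x
  for all x.\<close>

lemma cycline_unique:
  assumes "cycline \<mu> h \<nu>" "cycline \<mu> h' \<nu>'" "d \<nu> = d \<nu>'"
  shows "\<nu> = \<nu>'" "h = h'"
proof -
  note c = cyclineD[OF assms(1)] and e = cyclineD[OF assms(2)]
  note ci = cyclineD[OF cycline_inv[OF assms(1)]] and ei = cyclineD[OF cycline_inv[OF assms(2)]]
  obtain y where y: "y \<in> I (s \<mu>)" using infinite_path_exists[of "s \<mu>"] c(1) by auto
  show \<nu>: "\<nu> = \<nu>'"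
    by (rule concat_inf_cancel(1)[OF c(2) ci(7)[OF y] e(2) ei(7)[OF y] assms(3)])
      (simp add: ci(6)[OF y] ei(6)[OF y])
  show "h = h'"
  proof (rule faithful_on_infinite_paths)
    fix x assume "x \<in> I (dm h)"
    then have x: "x \<in> I (s \<nu>)" "x \<in> I (s \<nu>')" using c \<nu> by simp_all
    show "ia h x = ia h' x"
      by (rule concat_inf_cancel(2)[OF c(1) c(7)[OF x(1)] e(1) e(7)[OF x(2)] refl])
        (simp add: c(6)[OF x(1)] e(6)[OF x(2)] \<nu>)
  qed (use c e \<nu> in auto)
qed

section \<open>Cycline triples and periods\<close>

lemma shift_shift: "shift p (shift q x) = shift (p + q) x"
  by (auto simp: shift_def add.assoc)

text \<open>Shift the common path \<mu>(h x) = \<nu>x by d \<mu> + d \<nu>, removing \<nu> first on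
  one side and \<mu> first on the other.\<close>

lemma cycline_imp_Per:
  assumes "cycline \<mu> h \<nu>"
  shows "ddiff (d \<mu>) (d \<nu>) \<in> Per \<Lambda> G \<phi>"
proof -
  note c = cyclineD[OF assms]
  have "shift (d \<mu>) x = shift (d \<nu>) (ia h x)" if "x \<in> I (dm h)" for x
  proof -
    have x: "x \<in> I (s \<nu>)" using that c by simp
    have "shift (d \<nu>) (ia h x) = shift (d \<nu>) (shift (d \<mu>) (concat_inf \<Lambda> \<nu> x))"
      using concat_inf_props(4)[OF c(1) c(7)[OF x]] c(6)[OF x] by simp
    also have "\<dots> = shift (d \<mu>) (shift (d \<nu>) (concat_inf \<Lambda> \<nu> x))"
      by (simp add: shift_shift add.commute)
    finally show ?thesis using concat_inf_props(4)[OF c(2) x] by simp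
  qed
  then show ?thesis using c(3) unfolding Per_def by blast
qed

text \<open>
  A period \<open>p\<^sub>0 - q\<^sub>0 = p - q\<close>, witnessed by \<open>g\<close>, is transported to a given \<open>\<mu>\<close> of degree \<open>p\<close> by
  connecting the codomain of \<open>g\<close> to \<open>\<mu>\<close>: choose a path \<open>\<rho> \<tau> \<mu>\<close> out of \<open>cod g\<close> with \<open>d \<rho> = q\<^sub>0\<close>,
  and apply periodicity to infinite paths starting with its preimage under \<open>g\<close>.
\<close>

lemma cycline_exists:
  assumes per: "ddiff p q \<in> Per \<Lambda> G \<phi>" and \<mu>: "\<mu> \<in> P" "d \<mu> = p"
  obtains h \<nu> where "cycline \<mu> h \<nu>" "d \<nu> = q"
proof -
  obtain p0 q0 g where g: "g \<in> arrs" and eq: "ddiff p q = ddiff p0 q0"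
    and shift: "\<And>x. x \<in> I (dm g) \<Longrightarrow> shift p0 x = shift q0 (ia g x)"
    using per unfolding Per_def by auto
  have deg: "p + q0 = p0 + q" using eq ddiff_eq_iff by blast
  obtain \<rho> where \<rho>: "\<rho> \<in> P" "r \<rho> = cd g" "d \<rho> = q0" using no_sources[of "cd g" q0] g by auto
  obtain \<tau> where \<tau>: "\<tau> \<in> P" "r \<tau> = s \<rho>" "s \<tau> = r \<mu>" using connect[of "s \<rho>" "r \<mu>"] \<rho> \<mu> by auto
  define \<kappa> where "\<kappa> = \<tau> \<bullet> \<mu>"
  have \<kappa>: "\<kappa> \<in> P" "r \<kappa> = s \<rho>" "s \<kappa> = s \<mu>" "d \<kappa> = d \<tau> + p" using \<tau> \<mu> by (auto simp: \<kappa>_def)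
  \<comment> \<open>The preimage under g of the chosen path \<rho> \<tau> \<mu>.\<close>
  define \<sigma> where "\<sigma> = iv g \<rhd> (\<rho> \<bullet> \<kappa>)"
  have \<sigma>: "\<sigma> \<in> P" "r \<sigma> = dm g" "d \<sigma> = q0 + (d \<tau> + p)" "g \<rhd> \<sigma> = \<rho> \<bullet> \<kappa>"
    using \<rho> \<kappa> g by (auto simp: \<sigma>_def act_inv)
  \<comment> \<open>Since p + q0 = p0 + q, \<sigma> also factors as \<alpha> \<tau>' \<nu> with
    degrees p0, d \<tau> and q. The last factor is the required \<nu>, and g restricted to \<sigma>
    is the required h.\<close>
  have "d \<sigma> = p0 + (d \<tau> + q)"
    using \<sigma>(3) arg_cong[OF deg, of "\<lambda>n. d \<tau> + n"] by (simp add: ac_simps)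
  then obtain \<alpha> \<beta> where \<alpha>: "\<alpha> \<in> P" "\<beta> \<in> P" "s \<alpha> = r \<beta>" "\<sigma> = \<alpha> \<bullet> \<beta>" "d \<alpha> = p0" "d \<beta> = d \<tau> + q"
    using factorise[OF \<sigma>(1)] by metis
  then obtain \<tau>' \<nu> where \<nu>: "\<tau>' \<in> P" "\<nu> \<in> P" "s \<tau>' = r \<nu>" "\<beta> = \<tau>' \<bullet> \<nu>" "d \<tau>' = d \<tau>" "d \<nu> = q"
    using factorise[of \<beta>] by metis
  define h where "h = rs g \<sigma>"
  have h: "h \<in> arrs" "dm h = s \<nu>" "cd h = s \<mu>"
    using g \<sigma> \<alpha> \<nu> \<kappa> \<rho> by (auto simp: h_def)
  \<comment> \<open>Periodicity of the infinite path \<sigma>x: removing \<alpha> from it leaves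
    \<tau>'\<nu>x, removing \<rho> from its image under g leaves \<tau>\<mu>(h x). As \<tau> and
    \<tau>' have equal degree, they can be cancelled afterwards.\<close>
  have key: "concat_inf \<Lambda> \<tau>' (concat_inf \<Lambda> \<nu> x) = concat_inf \<Lambda> \<tau> (concat_inf \<Lambda> \<mu> (ia h x))"
    and hx: "ia h x \<in> I (s \<mu>)" if x: "x \<in> I (s \<nu>)" for x
  proof -
    show hx: "ia h x \<in> I (s \<mu>)" using act_inf_props(1)[OF h(1), of x] h x by simp
    have x': "x \<in> I (s \<beta>)" "x \<in> I (s \<sigma>)" using x \<nu> \<alpha> by auto
    have \<beta>x: "concat_inf \<Lambda> \<beta> x \<in> I (s \<alpha>)" using concat_inf_props(1)[OF \<alpha>(2) x'(1)] \<alpha>(3) by simp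
    have hx': "ia h x \<in> I (s \<kappa>)" using hx \<kappa> by simp
    have \<kappa>x: "concat_inf \<Lambda> \<kappa> (ia h x) \<in> I (s \<rho>)" using concat_inf_props(1)[OF \<kappa>(1) hx'] \<kappa>(2) by simp
    have \<sigma>x: "concat_inf \<Lambda> \<sigma> x \<in> I (dm g)" using concat_inf_props(1)[OF \<sigma>(1) x'(2)] \<sigma>(2) by simp
    have "concat_inf \<Lambda> \<beta> x = shift p0 (concat_inf \<Lambda> \<sigma> x)"
      using concat_inf_props(4)[OF \<alpha>(1) \<beta>x] concat_inf_comp[OF \<alpha>(1-3) x'(1)] \<alpha> by simp
    also have "\<dots> = shift q0 (ia g (concat_inf \<Lambda> \<sigma> x))" by (rule shift[OF \<sigma>x])
    also have "\<dots> = shift q0 (concat_inf \<Lambda> (\<rho> \<bullet> \<kappa>) (ia h x))"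
      using act_inf_concat[OF g \<sigma>(1,2) x'(2)] \<sigma>(4) by (simp add: h_def)
    also have "\<dots> = concat_inf \<Lambda> \<kappa> (ia h x)"
      using concat_inf_props(4)[OF \<rho>(1) \<kappa>x] concat_inf_comp[OF \<rho>(1) \<kappa>(1) _ hx'] \<kappa> \<rho> by simp
    finally show "concat_inf \<Lambda> \<tau>' (concat_inf \<Lambda> \<nu> x) = concat_inf \<Lambda> \<tau> (concat_inf \<Lambda> \<mu> (ia h x))"
      using concat_inf_comp[OF \<nu>(1-3) x] concat_inf_comp[OF \<tau>(1) \<mu>(1) \<tau>(3) hx] \<nu>(4)
      by (simp add: \<kappa>_def)
  qed
  have "concat_inf \<Lambda> \<mu> (ia h x) = concat_inf \<Lambda> \<nu> x" if x: "x \<in> I (s \<nu>)" for x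
  proof (rule concat_inf_cancel(2)[symmetric])
    show "concat_inf \<Lambda> \<nu> x \<in> I (s \<tau>')" using concat_inf_props(1)[OF \<nu>(2) x] \<nu> by simp
    show "concat_inf \<Lambda> \<mu> (ia h x) \<in> I (s \<tau>)" using concat_inf_props(1)[OF \<mu>(1) hx[OF x]] \<tau> by simp
  qed (use key[OF x] \<nu> \<tau> in auto)
  then have "cycline \<mu> h \<nu>" using h \<mu> \<nu> by (simp add: cycline_def)
  then show ?thesis using that \<nu>(6) by blast
qed

text \<open>\<open>cycline_unique\<close> is what makes the definite description meaningful: its
  predicate is the cycline condition with prescribed degrees.\<close>

lemma theta_h_eq:
  assumes "cycline \<mu> h \<nu>"
  shows "theta_h \<Lambda> G \<phi> (d \<mu>) (d \<nu>) \<mu> = (\<nu>, h)"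
proof -
  note c = cyclineD[OF assms]
  have iff: "\<nu>' \<in> paths_deg \<Lambda> (d \<nu>) \<and> h' \<in> arrs \<and> cd h' = s \<mu> \<and> dm h' = s \<nu>' \<and>
      (\<forall>x\<in>I (dm h'). concat_inf \<Lambda> \<mu> (ia h' x) = concat_inf \<Lambda> \<nu>' x) \<longleftrightarrow> cycline \<mu> h' \<nu>' \<and> d \<nu>' = d \<nu>"
    for \<nu>' h'
    using c(1) by (auto simp: cycline_def in_paths_deg)
  show ?thesis
    unfolding theta_h_def iff
  proof (rule the_equality)
    fix x assume "case x of (\<nu>', h') \<Rightarrow> cycline \<mu> h' \<nu>' \<and> d \<nu>' = d \<nu>"
    then show "x = (\<nu>, h)"
      using cycline_unique[of \<mu> "snd x" "fst x" h \<nu>] assms by (cases x) auto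
  qed (use assms in simp)
qed

lemma theta_hper_eq:
  assumes "cycline \<mu> h \<nu>" "d \<mu> = p" "d \<nu> = q"
  shows "theta \<Lambda> G \<phi> p q \<mu> = \<nu>" "hper \<Lambda> G \<phi> p q \<mu> = h"
  using theta_h_eq[OF assms(1)] assms by (simp_all add: theta_def hper_def)

lemma cycline_theta:
  assumes "ddiff p q \<in> Per \<Lambda> G \<phi>" "\<mu> \<in> paths_deg \<Lambda> p"
  shows "cycline \<mu> (hper \<Lambda> G \<phi> p q \<mu>) (theta \<Lambda> G \<phi> p q \<mu>)" "d (theta \<Lambda> G \<phi> p q \<mu>) = q"
proof -
  have \<mu>: "\<mu> \<in> P" "d \<mu> = p" using assms(2) by (simp_all add: in_paths_deg)
  obtain h \<nu> where "cycline \<mu> h \<nu>" "d \<nu> = q" using cycline_exists[OF assms(1) \<mu>] .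
  then show "cycline \<mu> (hper \<Lambda> G \<phi> p q \<mu>) (theta \<Lambda> G \<phi> p q \<mu>)" "d (theta \<Lambda> G \<phi> p q \<mu>) = q"
    using theta_hper_eq assms(2) by (auto simp: in_paths_deg)
qed

section \<open>The group of periods\<close>

lemma Per_zero: "0 \<in> Per \<Lambda> G \<phi>"
proof -
  obtain \<mu> where "\<mu> \<in> P" using paths_deg_nonempty by blast
  then show ?thesis using cycline_imp_Per[OF cycline_unit] by (simp add: ddiff_self)
qed

lemma Per_ddiff_swap:
  assumes "ddiff p q \<in> Per \<Lambda> G \<phi>"
  shows "ddiff q p \<in> Per \<Lambda> G \<phi>"
proof -
  obtain \<mu> where \<mu>: "\<mu> \<in> P" "d \<mu> = p" using paths_deg_nonempty by blast
  then show ?thesis using cycline_exists[OF assms \<mu>] cycline_imp_Per[OF cycline_inv] by metis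
qed

lemma Per_ddiff_trans:
  assumes "ddiff p q \<in> Per \<Lambda> G \<phi>" "ddiff q n \<in> Per \<Lambda> G \<phi>"
  shows "ddiff p n \<in> Per \<Lambda> G \<phi>"
proof -
  obtain \<mu> where \<mu>: "\<mu> \<in> P" "d \<mu> = p" using paths_deg_nonempty by blast
  obtain h \<nu> where h: "cycline \<mu> h \<nu>" "d \<nu> = q" using cycline_exists[OF assms(1) \<mu>] by blast
  obtain k \<rho> where k: "cycline \<nu> k \<rho>" "d \<rho> = n"
    using cycline_exists[OF assms(2) cyclineD(2)[OF h(1)] h(2)] by blast
  show ?thesis using cycline_imp_Per[OF cycline_mult[OF h(1) k(1)]] \<mu>(2) k(2) by simp
qed

lemma Per_obtain:
  assumes "a \<in> Per \<Lambda> G \<phi>"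
  obtains p q where "a = ddiff p q"
  using assms unfolding Per_def by blast

text \<open>Shifting the first pair by p' and the second by q makes q + p' the common middle
  degree.\<close>

lemma Per_obtain2:
  assumes "a \<in> Per \<Lambda> G \<phi>" "b \<in> Per \<Lambda> G \<phi>"
  obtains p q n where "a = ddiff p q" "b = ddiff q n"
proof -
  obtain p q p' q' where "a = ddiff p q" "b = ddiff p' q'" using Per_obtain assms by metis
  then have "a = ddiff (p + p') (q + p')" "b = ddiff (q + p') (q' + q)"
    using ddiff_shift by (metis, metis add.commute)
  then show ?thesis using that by blast
qed

lemma group_Per: "group (Per_group \<Lambda> G \<phi>)"
proof (rule groupI)
  fix a b assume "a \<in> carrier (Per_group \<Lambda> G \<phi>)" "b \<in> carrier (Per_group \<Lambda> G \<phi>)"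
  then have ab: "a \<in> Per \<Lambda> G \<phi>" "b \<in> Per \<Lambda> G \<phi>" by (simp_all add: Per_group_def)
  obtain p q n where "a = ddiff p q" "b = ddiff q n" using Per_obtain2[OF ab] .
  with ab show "a \<otimes>\<^bsub>Per_group \<Lambda> G \<phi>\<^esub> b \<in> carrier (Per_group \<Lambda> G \<phi>)"
    using Per_ddiff_trans[of p q n] by (simp add: Per_group_def ddiff_add)
next
  fix a assume "a \<in> carrier (Per_group \<Lambda> G \<phi>)"
  then have a: "a \<in> Per \<Lambda> G \<phi>" by (simp add: Per_group_def)
  obtain p q where "a = ddiff p q" using Per_obtain[OF a] .
  with a show "\<exists>b\<in>carrier (Per_group \<Lambda> G \<phi>). b \<otimes>\<^bsub>Per_group \<Lambda> G \<phi>\<^esub> a = \<one>\<^bsub>Per_group \<Lambda> G \<phi>\<^esub>"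
    using Per_ddiff_swap by (auto simp: Per_group_def ddiff_add ddiff_self intro!: bexI[of _ "ddiff q p"])
qed (auto simp: Per_group_def Per_zero add.assoc)

end

section \<open>C*-algebras\<close>

context cstar_algebra
begin

interpretation ring A by (rule ring)
interpretation scalar: module complex_ring A by (rule module)

lemma scale_closed: "x \<in> carrier A \<Longrightarrow> c \<odot> x \<in> carrier A"
  using scalar.smult_closed by (simp add: complex_ring_def)

lemma adj_zero: "adj A \<zero> = \<zero>"
  using adj_add[of \<zero> \<zero>] adj_closed[of \<zero>] add.l_cancel_one[of "adj A \<zero>" "adj A \<zero>"] by simp

lemma adj_one: "adj A \<one> = \<one>"
  using adj_mult[of \<one> "adj A \<one>"] adj_closed[of \<one>] adj_adj[of \<one>] by simp

lemma adj_finsum: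
  assumes "finite F" "f \<in> F \<rightarrow> carrier A"
  shows "adj A (finsum A f F) = finsum A (\<lambda>i. adj A (f i)) F"
  using assms by (induction F) (auto simp: adj_zero adj_add adj_closed Pi_def)

text \<open>The ring negative has to be identified with scaling by -1 before
  \<open>nrm_smult\<close> applies.\<close>

lemma nrm_minus: "x \<in> carrier A \<Longrightarrow> nrm A (\<ominus> x) = nrm A x"
proof -
  assume x: "x \<in> carrier A"
  have "\<zero> = (1 + - 1 :: complex) \<odot> x" using scalar.smult_l_null[OF x] by (simp add: complex_ring_def)
  also have "\<dots> = x \<oplus> (- 1) \<odot> x"
    using scalar.smult_l_distr[of 1 "- 1" x] scalar.smult_one[OF x] x by (simp add: complex_ring_def)
  finally have "(- 1) \<odot> x \<oplus> x = \<zero>" using scale_closed x by (simp add: a_comm)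
  then have "\<ominus> x = (- 1) \<odot> x" using scale_closed x by (intro minus_equality) auto
  then show ?thesis using nrm_smult[OF x, of "- 1"] by simp
qed

text \<open>Unitarity of V gives closure under adjoints; closure under limits is a norm estimate for
  the commutator.\<close>

lemma centralizer_subalgebra:
  assumes V: "V \<in> carrier A" and V1: "adj A V \<otimes> V = \<one>" "V \<otimes> adj A V = \<one>"
  shows "cstar_subalgebra {x \<in> carrier A. V \<otimes> x = x \<otimes> V} A"
  unfolding cstar_subalgebra_def
proof (intro conjI ballI allI impI; (elim conjE)?)
  fix x assume "x \<in> {x \<in> carrier A. V \<otimes> x = x \<otimes> V}"
  then have x: "x \<in> carrier A" "V \<otimes> x = x \<otimes> V" by auto
  note c = V adj_closed[OF V] x(1)
  show "c \<odot> x \<in> {x \<in> carrier A. V \<otimes> x = x \<otimes> V}" for c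
    using x V by (simp add: scale_closed smult_mult_left smult_mult_right)
  \<comment> \<open>Insert V V* = 1 on the right and move V past x: x commutes with V*, so by taking
    adjoints x* commutes with V.\<close>
  have "adj A V \<otimes> x = adj A V \<otimes> (x \<otimes> V) \<otimes> adj A V"
    using c V1(2) by (simp add: m_assoc)
  also have "\<dots> = (adj A V \<otimes> V) \<otimes> x \<otimes> adj A V"
    using c x(2) by (simp add: m_assoc)
  finally have "adj A V \<otimes> x = x \<otimes> adj A V" using V1(1) c by simp
  then have "adj A (adj A V \<otimes> x) = adj A (x \<otimes> adj A V)" by simp
  then show "adj A x \<in> {x \<in> carrier A. V \<otimes> x = x \<otimes> V}"
    using c by (simp add: adj_mult adj_adj adj_closed)
next
  fix x y assume "x \<in> {x \<in> carrier A. V \<otimes> x = x \<otimes> V}" "y \<in> {x \<in> carrier A. V \<otimes> x = x \<otimes> V}"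
  then have x: "x \<in> carrier A" "V \<otimes> x = x \<otimes> V" and y: "y \<in> carrier A" "V \<otimes> y = y \<otimes> V" by auto
  show "x \<oplus> y \<in> {x \<in> carrier A. V \<otimes> x = x \<otimes> V}" using x y V by (simp add: l_distr r_distr)
  have "V \<otimes> (x \<otimes> y) = x \<otimes> (V \<otimes> y)" using x y V by (metis m_assoc)
  then show "x \<otimes> y \<in> {x \<in> carrier A. V \<otimes> x = x \<otimes> V}" using x y V by (simp add: m_assoc)
next
  fix f a assume f: "\<forall>n::nat. f n \<in> {x \<in> carrier A. V \<otimes> x = x \<otimes> V}" and a: "a \<in> carrier A"
    and lim: "(\<lambda>n. nrm A (f n \<ominus> a)) \<longlonglongrightarrow> 0"
  have fn: "f n \<in> carrier A" "V \<otimes> f n = f n \<otimes> V" for n using f by auto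
  \<comment> \<open>With e = f n - a, the commutator of V and a equals eV - Ve because f n commutes
    with V.\<close>
  have bound: "nrm A (V \<otimes> a \<ominus> a \<otimes> V) \<le> 2 * nrm A V * nrm A (f n \<ominus> a)" for n
  proof -
    define e where "e = f n \<ominus> a"
    have e: "e \<in> carrier A" "a = f n \<ominus> e"
      using fn a by (auto simp: e_def minus_eq minus_add r_neg l_neg a_ac)
    have cancel: "f n \<otimes> V \<oplus> (\<ominus> (V \<otimes> e) \<oplus> \<ominus> (f n \<otimes> V)) = \<ominus> (V \<otimes> e)"
      using V fn(1)[of n] e(1) by (subst a_lcomm) (auto simp: r_neg)
    have "V \<otimes> a \<ominus> a \<otimes> V = e \<otimes> V \<oplus> \<ominus> (V \<otimes> e)"
      unfolding e(2) minus_eq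
      using V fn[of n] e(1) cancel
      by (simp add: l_distr r_distr l_minus r_minus minus_add a_ac r_neg1 r_neg2)
    then have "nrm A (V \<otimes> a \<ominus> a \<otimes> V) \<le> nrm A (e \<otimes> V) + nrm A (V \<otimes> e)"
      using nrm_triangle[of "e \<otimes> V" "\<ominus> (V \<otimes> e)"] V e(1) by (simp add: nrm_minus)
    also have "\<dots> \<le> nrm A e * nrm A V + nrm A V * nrm A e"
      using nrm_mult[of e V] nrm_mult[of V e] V e(1) by (intro add_mono) auto
    finally show ?thesis by (simp add: e_def)
  qed
  have "(\<lambda>n. 2 * nrm A V * nrm A (f n \<ominus> a)) \<longlonglongrightarrow> 2 * nrm A V * 0"
    by (intro tendsto_intros lim)
  then have "nrm A (V \<otimes> a \<ominus> a \<otimes> V) \<le> 0"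
    using bound by (intro LIMSEQ_le_const) auto
  then have "V \<otimes> a \<ominus> a \<otimes> V = \<zero>"
    using nrm_nonneg[of "V \<otimes> a \<ominus> a \<otimes> V"] nrm_eq_0[of "V \<otimes> a \<ominus> a \<otimes> V"] V a by simp
  then show "a \<in> {x \<in> carrier A. V \<otimes> x = x \<otimes> V}"
    using V a minus_unique[of "V \<otimes> a" "\<ominus> (a \<otimes> V)" "a \<otimes> V"] by (simp add: minus_eq r_neg l_neg)
qed (use V in auto)

lemma group_central_unitaries: "group (central_unitaries A)"
proof (rule groupI)
  fix x y assume "x \<in> carrier (central_unitaries A)" "y \<in> carrier (central_unitaries A)"
  then have x: "x \<in> carrier A" "adj A x \<otimes> x = \<one>" "x \<otimes> adj A x = \<one>" "\<And>z. z \<in> carrier A \<Longrightarrow> x \<otimes> z = z \<otimes> x"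
    and y: "y \<in> carrier A" "adj A y \<otimes> y = \<one>" "y \<otimes> adj A y = \<one>" "\<And>z. z \<in> carrier A \<Longrightarrow> y \<otimes> z = z \<otimes> y"
    by (auto simp: central_unitaries_def centre_def)
  note c = x(1) y(1) adj_closed[OF x(1)] adj_closed[OF y(1)]
  have "x \<otimes> y \<otimes> z = z \<otimes> (x \<otimes> y)" if z: "z \<in> carrier A" for z
    using c z x(4)[OF z] y(4)[OF z] by (metis m_assoc)
  moreover have "adj A y \<otimes> adj A x \<otimes> (x \<otimes> y) = \<one>"
  proof -
    have "adj A y \<otimes> adj A x \<otimes> (x \<otimes> y) = adj A y \<otimes> ((adj A x \<otimes> x) \<otimes> y)" using c by (simp add: m_assoc)
    then show ?thesis using x(1-3) y(1-3) by simp
  qed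
  moreover have "x \<otimes> y \<otimes> (adj A y \<otimes> adj A x) = \<one>"
  proof -
    have "x \<otimes> y \<otimes> (adj A y \<otimes> adj A x) = x \<otimes> ((y \<otimes> adj A y) \<otimes> adj A x)" using c by (simp add: m_assoc)
    then show ?thesis using x(1-3) y(1-3) c by simp
  qed
  ultimately show "x \<otimes>\<^bsub>central_unitaries A\<^esub> y \<in> carrier (central_unitaries A)"
    using c by (simp add: central_unitaries_def centre_def adj_mult)
next
  fix x assume "x \<in> carrier (central_unitaries A)"
  then have x: "x \<in> carrier A" "adj A x \<otimes> x = \<one>" "x \<otimes> adj A x = \<one>" "\<And>z. z \<in> carrier A \<Longrightarrow> x \<otimes> z = z \<otimes> x"
    by (auto simp: central_unitaries_def centre_def)
  have central: "adj A x \<otimes> z = z \<otimes> adj A x" if z: "z \<in> carrier A" for z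
    using arg_cong[OF x(4)[OF adj_closed[OF z]], of "adj A"] x(1) z adj_closed
    by (simp add: adj_mult adj_adj)
  have "adj A x \<in> carrier (central_unitaries A)"
    using x(1-3) by (simp add: central_unitaries_def centre_def adj_adj adj_closed) (auto intro: central)
  then show "\<exists>y\<in>carrier (central_unitaries A). y \<otimes>\<^bsub>central_unitaries A\<^esub> x = \<one>\<^bsub>central_unitaries A\<^esub>"
    using x(2) by (auto simp: central_unitaries_def)
next
  show "\<one>\<^bsub>central_unitaries A\<^esub> \<in> carrier (central_unitaries A)"
    by (simp add: central_unitaries_def centre_def adj_one)
next
  fix x y z
  assume "x \<in> carrier (central_unitaries A)" "y \<in> carrier (central_unitaries A)" "z \<in> carrier (central_unitaries A)"
  then have "x \<in> carrier A" "y \<in> carrier A" "z \<in> carrier A" by (auto simp: central_unitaries_def centre_def)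
  then show "x \<otimes>\<^bsub>central_unitaries A\<^esub> y \<otimes>\<^bsub>central_unitaries A\<^esub> z =
      x \<otimes>\<^bsub>central_unitaries A\<^esub> (y \<otimes>\<^bsub>central_unitaries A\<^esub> z)"
    by (simp add: central_unitaries_def m_assoc)
next
  fix x assume "x \<in> carrier (central_unitaries A)"
  then have "x \<in> carrier A" by (auto simp: central_unitaries_def centre_def)
  then show "\<one>\<^bsub>central_unitaries A\<^esub> \<otimes>\<^bsub>central_unitaries A\<^esub> x = x"
    by (simp add: central_unitaries_def)
qed

end

section \<open>The central unitaries\<close>

locale cuntz_pimsner_rep =
  periodic_graph \<Lambda> G \<phi> + cstar_algebra A
  for \<Lambda> :: "('k::finite, 'l) kgraph" and G :: "('l, 'g) groupoid" and \<phi> :: "'g \<Rightarrow> 'l piso"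
    and A :: "'a cstar" (structure) +
  fixes u :: "'g \<Rightarrow> 'a" and t :: "'l \<Rightarrow> 'a"
  assumes finite_kgraph: "finite_kgraph \<Lambda>" and CP: "CP_family \<Lambda> G \<phi> A u t"
begin

interpretation ring A by (rule ring)

section \<open>Consequences of the defining relations\<close>

lemma u_closed [simp]: "g \<in> arrs \<Longrightarrow> u g \<in> carrier A"
  and adj_u: "g \<in> arrs \<Longrightarrow> adj A (u g) = u (iv g)"
  and u_mult: "g \<in> arrs \<Longrightarrow> h \<in> arrs \<Longrightarrow> u g \<otimes> u h = (if dm g = cd h then u (g \<star> h) else \<zero>)"
  and u_unit: "v \<in> vertices \<Lambda> \<Longrightarrow> u (un v) = t v"
  using CP by (auto simp: CP_family_def unitary_rep_def partial_isometry_def)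

lemma u_t: "g \<in> arrs \<Longrightarrow> \<mu> \<in> P \<Longrightarrow>
    u g \<otimes> t \<mu> = (if dm g = r \<mu> then t (g \<rhd> \<mu>) \<otimes> u (rs g \<mu>) else \<zero>)"
  using CP by (auto simp: CP_family_def)

lemma TCK: "TCK_family \<Lambda> A t"
  using CP by (auto simp: CP_family_def CK_family_def)

lemma t_closed [simp]: "\<mu> \<in> P \<Longrightarrow> t \<mu> \<in> carrier A"
  and t_comp: "\<mu> \<in> P \<Longrightarrow> \<nu> \<in> P \<Longrightarrow> s \<mu> = r \<nu> \<Longrightarrow> t \<mu> \<otimes> t \<nu> = t (\<mu> \<bullet> \<nu>)"
  and t_orth: "v \<in> vertices \<Lambda> \<Longrightarrow> w \<in> vertices \<Lambda> \<Longrightarrow> v \<noteq> w \<Longrightarrow> t v \<otimes> t w = \<zero>"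
  and adj_vertex: "v \<in> vertices \<Lambda> \<Longrightarrow> adj A (t v) = t v"
  using TCK by (auto simp: TCK_family_def partial_isometry_def orthogonal_projections_def)

lemma adj_t_closed [simp]: "\<mu> \<in> P \<Longrightarrow> adj A (t \<mu>) \<in> carrier A"
  by (simp add: adj_closed)

text \<open>Insert the projections of \<open>s \<mu>\<close> and \<open>r \<nu>\<close>, which are
  orthogonal.\<close>

lemma t_mult_zero:
  assumes "\<mu> \<in> P" "\<nu> \<in> P" "s \<mu> \<noteq> r \<nu>"
  shows "t \<mu> \<otimes> t \<nu> = \<zero>"
proof -
  have "t \<mu> \<otimes> t \<nu> = (t \<mu> \<otimes> t (s \<mu>)) \<otimes> (t (r \<nu>) \<otimes> t \<nu>)" using assms by (simp add: t_comp)
  also have "\<dots> = t \<mu> \<otimes> (t (s \<mu>) \<otimes> t (r \<nu>)) \<otimes> t \<nu>" using assms by (simp add: m_assoc)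
  also have "\<dots> = \<zero>" using assms t_orth by simp
  finally show ?thesis .
qed

text \<open>For equal degrees a minimal common extension adds degree 0, so it exists only when \<mu>
  = \<nu> and is then trivial.\<close>

lemma adj_t_t:
  assumes "\<mu> \<in> P" "\<nu> \<in> P" "d \<mu> = d \<nu>"
  shows "adj A (t \<mu>) \<otimes> t \<nu> = (if \<mu> = \<nu> then t (s \<mu>) else \<zero>)"
proof -
  have ext: "(\<eta>, \<zeta>) \<in> min_ext \<Lambda> \<mu> \<nu> \<longleftrightarrow> \<mu> = \<nu> \<and> \<eta> = s \<mu> \<and> \<zeta> = s \<mu>" for \<eta> \<zeta>
  proof
    assume "(\<eta>, \<zeta>) \<in> min_ext \<Lambda> \<mu> \<nu>"
    then have e: "\<eta> \<in> P" "r \<eta> = s \<mu>" "\<zeta> \<in> P" "r \<zeta> = s \<nu>" "\<mu> \<bullet> \<eta> = \<nu> \<bullet> \<zeta>" "d (\<mu> \<bullet> \<eta>) = d \<mu>"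
      using assms by (auto simp: min_ext_def in_paths_from)
    have "\<mu> = \<nu>" "\<eta> = \<zeta>"
      using comp_cancel[OF assms(1) e(1) e(2)[symmetric] assms(2) e(3) e(4)[symmetric] e(5) assms(3)] .
    moreover have "d \<eta> = 0" using comp_simps(4)[OF assms(1) e(1) e(2)[symmetric]] e(6) by simp
    ultimately show "\<mu> = \<nu> \<and> \<eta> = s \<mu> \<and> \<zeta> = s \<mu>" using vertexD(3)[OF vertexI] e by metis
  next
    assume "\<mu> = \<nu> \<and> \<eta> = s \<mu> \<and> \<zeta> = s \<mu>"
    then show "(\<eta>, \<zeta>) \<in> min_ext \<Lambda> \<mu> \<nu>" using assms by (auto simp: min_ext_def in_paths_from)
  qed
  have eq: "adj A (t \<mu>) \<otimes> t \<nu> = (\<Oplus>\<eta>\<zeta>\<in>min_ext \<Lambda> \<mu> \<nu>. t (fst \<eta>\<zeta>) \<otimes> adj A (t (snd \<eta>\<zeta>)))"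
    using TCK assms by (auto simp: TCK_family_def)
  show ?thesis
  proof (cases "\<mu> = \<nu>")
    case True
    then have "min_ext \<Lambda> \<mu> \<nu> = {(s \<mu>, s \<mu>)}" using ext by auto
    then have "adj A (t \<mu>) \<otimes> t \<nu> = t (s \<mu>) \<otimes> adj A (t (s \<mu>))"
      using assms by (simp add: eq Pi_def)
    then show ?thesis
      using True assms path_simps(8)[OF path_simps(2)[OF assms(1)]] by (simp add: adj_vertex t_comp)
  next
    case False
    then have "min_ext \<Lambda> \<mu> \<nu> = {}" using ext by auto
    then show ?thesis using False by (simp add: eq)
  qed
qed

lemma finite_paths_deg: "finite (paths_deg \<Lambda> p)"
  using finite_kgraph by (auto simp: finite_kgraph_def)

text \<open>Since the \<open>t v\<close> sum to 1, the Cuntz--Krieger relation at each vertex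
  expresses z as the sum of \<open>(z \<otimes> t \<nu>) \<otimes> adj A (t \<nu>)\<close> over all
  \<nu> of degree q. The degree q is free and is chosen to fit each application.\<close>

lemma eqI_on_paths:
  assumes x: "x \<in> carrier A" and y: "y \<in> carrier A"
    and eq: "\<And>\<nu>. \<nu> \<in> P \<Longrightarrow> d \<nu> = q \<Longrightarrow> x \<otimes> t \<nu> = y \<otimes> t \<nu>"
  shows "x = y"
proof -
  have vert: "z \<otimes> t v = (\<Oplus>\<nu>\<in>paths_from \<Lambda> v \<inter> paths_deg \<Lambda> q. (z \<otimes> t \<nu>) \<otimes> adj A (t \<nu>))"
    if z: "z \<in> carrier A" and v: "v \<in> vertices \<Lambda>" for z v
  proof -
    have "t v = (\<Oplus>\<nu>\<in>paths_from \<Lambda> v \<inter> paths_deg \<Lambda> q. t \<nu> \<otimes> adj A (t \<nu>))"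
      using CP v by (auto simp: CP_family_def CK_family_def)
    then have "z \<otimes> t v = (\<Oplus>\<nu>\<in>paths_from \<Lambda> v \<inter> paths_deg \<Lambda> q. z \<otimes> (t \<nu> \<otimes> adj A (t \<nu>)))"
      using finsum_rdistr[of "paths_from \<Lambda> v \<inter> paths_deg \<Lambda> q" z "\<lambda>\<nu>. t \<nu> \<otimes> adj A (t \<nu>)"] z finite_paths_deg
      by (simp add: Pi_def in_paths_deg)
    also have "\<dots> = (\<Oplus>\<nu>\<in>paths_from \<Lambda> v \<inter> paths_deg \<Lambda> q. (z \<otimes> t \<nu>) \<otimes> adj A (t \<nu>))"
      using z by (intro finsum_cong') (auto simp: m_assoc in_paths_deg)
    finally show ?thesis .
  qed
  have xy: "x \<otimes> t v = y \<otimes> t v" if "v \<in> vertices \<Lambda>" for v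
    unfolding vert[OF x that] vert[OF y that]
    using x y by (intro finsum_cong') (auto simp: eq in_paths_deg)
  have one: "z = (\<Oplus>v\<in>vertices \<Lambda>. z \<otimes> t v)" if "z \<in> carrier A" for z
  proof -
    have "(\<Oplus>v\<in>vertices \<Lambda>. t v) = \<one>" using CP by (auto simp: CP_family_def)
    then show ?thesis
      using finsum_rdistr[of "vertices \<Lambda>" z t] that finite_paths_deg[of 0]
      by (simp add: vertices_def Pi_def in_paths_deg)
  qed
  have "(\<Oplus>v\<in>vertices \<Lambda>. x \<otimes> t v) = (\<Oplus>v\<in>vertices \<Lambda>. y \<otimes> t v)"
    using x y by (intro finsum_cong') (auto simp: xy dest: vertexD)
  then show ?thesis using one x y by simp
qed

text \<open>Indexed by the pair for now; \<open>V_cong\<close> reduces this to the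
  difference.\<close>

definition V :: "'k degree \<Rightarrow> 'k degree \<Rightarrow> 'a" where
  "V p q = (\<Oplus>\<mu>\<in>paths_deg \<Lambda> p.
     t \<mu> \<otimes> u (hper \<Lambda> G \<phi> p q \<mu>) \<otimes> adj A (t (theta \<Lambda> G \<phi> p q \<mu>)))"

lemma V_summand_closed:
  assumes "ddiff p q \<in> Per \<Lambda> G \<phi>"
  shows "(\<lambda>\<mu>. t \<mu> \<otimes> u (hper \<Lambda> G \<phi> p q \<mu>) \<otimes> adj A (t (theta \<Lambda> G \<phi> p q \<mu>))) \<in> paths_deg \<Lambda> p \<rightarrow> carrier A"
  using cyclineD(1-3)[OF cycline_theta(1)[OF assms]] by auto

lemma V_closed: "ddiff p q \<in> Per \<Lambda> G \<phi> \<Longrightarrow> V p q \<in> carrier A"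
  unfolding V_def by (intro finsum_closed V_summand_closed)

text \<open>By \<open>adj_t_t\<close> only summands \<kappa> whose companion \<theta>(\<kappa>) is
  \<nu> survive, and \<kappa> = \<mu> is the only one.\<close>

lemma V_t:
  assumes per: "ddiff p q \<in> Per \<Lambda> G \<phi>" and cyc: "cycline \<mu> h \<nu>" and deg: "d \<mu> = p" "d \<nu> = q"
  shows "V p q \<otimes> t \<nu> = t \<mu> \<otimes> u h"
proof -
  note c = cyclineD[OF cyc]
  let ?f = "\<lambda>\<mu>. t \<mu> \<otimes> u (hper \<Lambda> G \<phi> p q \<mu>) \<otimes> adj A (t (theta \<Lambda> G \<phi> p q \<mu>))"
  have summand: "?f \<kappa> \<otimes> t \<nu> = (if \<mu> = \<kappa> then t \<mu> \<otimes> u h else \<zero>)" if \<kappa>: "\<kappa> \<in> paths_deg \<Lambda> p" for \<kappa>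
  proof -
    let ?h = "hper \<Lambda> G \<phi> p q \<kappa>" and ?\<theta> = "theta \<Lambda> G \<phi> p q \<kappa>"
    have \<theta>: "cycline \<kappa> ?h ?\<theta>" "d ?\<theta> = q" using cycline_theta[OF per \<kappa>] by auto
    note e = cyclineD[OF \<theta>(1)]
    have prod: "?f \<kappa> \<otimes> t \<nu> = t \<kappa> \<otimes> u ?h \<otimes> (adj A (t ?\<theta>) \<otimes> t \<nu>)" using c e by (simp add: m_assoc)
    show ?thesis
    proof (cases "\<mu> = \<kappa>")
      case True
      then have eq: "?\<theta> = \<nu>" "?h = h" using theta_hper_eq[OF cyc deg] by simp_all
      \<comment> \<open>The projection left over from \<open>adj_t_t\<close> is absorbed, since h
        has domain \<open>s \<nu>\<close>.\<close>
      have "u h \<otimes> t (s \<nu>) = u h"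
        using u_mult[of h "un (s \<nu>)"] c arrow_simps(3)[OF c(3)] by (simp add: u_unit)
      then show ?thesis
        using prod True c by (simp add: eq adj_t_t m_assoc)
    next
      case False
      \<comment> \<open>Injectivity of \<theta>: the inverse triples of \<mu> and \<kappa> would
        share the left path \<nu> and the right degree p.\<close>
      then have "?\<theta> \<noteq> \<nu>"
        using cycline_unique(1)[OF cycline_inv[OF cyc]] cycline_inv[OF \<theta>(1)] \<kappa> deg
        by (auto simp: in_paths_deg)
      then show ?thesis using prod False c e \<theta>(2) deg by (simp add: adj_t_t)
    qed
  qed
  have "V p q \<otimes> t \<nu> = (\<Oplus>\<kappa>\<in>paths_deg \<Lambda> p. ?f \<kappa> \<otimes> t \<nu>)"
    unfolding V_def using c by (intro finsum_ldistr finite_paths_deg V_summand_closed per) simp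
  also have "\<dots> = (\<Oplus>\<kappa>\<in>paths_deg \<Lambda> p. if \<mu> = \<kappa> then t \<mu> \<otimes> u h else \<zero>)"
    using c by (intro finsum_cong') (auto simp: summand)
  also have "\<dots> = t \<mu> \<otimes> u h"
    using add.finprod_singleton[of \<mu> "paths_deg \<Lambda> p" "\<lambda>_. t \<mu> \<otimes> u h"] c deg finite_paths_deg
    by (simp add: in_paths_deg)
  finally show ?thesis .
qed

lemma cycline_exists_left:
  assumes "ddiff p q \<in> Per \<Lambda> G \<phi>" "\<nu> \<in> P" "d \<nu> = q"
  obtains \<mu> h where "cycline \<mu> h \<nu>" "d \<mu> = p"
  using cycline_exists[OF Per_ddiff_swap[OF assms(1)] assms(2,3)] cycline_inv by metis

text \<open>A test path of degree q + n splits as \<nu>\<rho>. Appending \<rho> to the triple of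
  \<nu> mirrors the relation that moves \<open>u h\<close> past \<open>t \<rho>\<close>.\<close>

lemma V_shift:
  assumes per: "ddiff p q \<in> Per \<Lambda> G \<phi>"
  shows "V (p + n) (q + n) = V p q"
proof (rule eqI_on_paths[where q = "q + n"])
  have per': "ddiff (p + n) (q + n) \<in> Per \<Lambda> G \<phi>" using per by (simp add: ddiff_shift)
  show "V (p + n) (q + n) \<in> carrier A" "V p q \<in> carrier A" using V_closed per per' by auto
  fix \<kappa> assume "\<kappa> \<in> P" "d \<kappa> = q + n"
  then obtain \<nu> \<rho> where \<nu>: "\<nu> \<in> P" "\<rho> \<in> P" "s \<nu> = r \<rho>" "\<kappa> = \<nu> \<bullet> \<rho>" "d \<nu> = q" "d \<rho> = n"
    using factorise by metis
  obtain \<mu> h where \<mu>: "cycline \<mu> h \<nu>" "d \<mu> = p" using cycline_exists_left[OF per \<nu>(1,5)] .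
  note c = cyclineD[OF \<mu>(1)]
  have "V (p + n) (q + n) \<otimes> t \<kappa> = t (\<mu> \<bullet> (h \<rhd> \<rho>)) \<otimes> u (rs h \<rho>)"
    using V_t[OF per' cycline_append[OF \<mu>(1) \<nu>(2) \<nu>(3)[symmetric]]] \<nu> \<mu> c by simp
  also have "\<dots> = t \<mu> \<otimes> (u h \<otimes> t \<rho>)"
    using c \<nu> by (simp add: u_t t_comp[symmetric] m_assoc)
  also have "\<dots> = (V p q \<otimes> t \<nu>) \<otimes> t \<rho>"
    using V_t[OF per \<mu> \<nu>(5)] c \<nu> by (simp add: m_assoc)
  also have "\<dots> = V p q \<otimes> t \<kappa>"
    using V_closed[OF per] \<nu> by (simp add: m_assoc t_comp)
  finally show "V (p + n) (q + n) \<otimes> t \<kappa> = V p q \<otimes> t \<kappa>" .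
qed

text \<open>Both pairs shift to (p + p', q + p'), which equals (p + p', q' + p) when the differences
  agree.\<close>

lemma V_cong:
  assumes "ddiff p q \<in> Per \<Lambda> G \<phi>" "ddiff p q = ddiff p' q'"
  shows "V p q = V p' q'"
proof -
  have "V p q = V (p + p') (q + p')" using V_shift assms by simp
  also have "q + p' = q' + p" using assms(2) by (simp add: ddiff_eq_iff add.commute)
  also have "V (p + p') (q' + p) = V p' q'" using V_shift[of p' q' p] assms by (simp add: add.commute)
  finally show ?thesis .
qed

lemma V_self: "V p p = \<one>"
proof (rule eqI_on_paths[where q = p])
  have per: "ddiff p p \<in> Per \<Lambda> G \<phi>" by (simp add: ddiff_self Per_zero)
  show "V p p \<in> carrier A" "\<one> \<in> carrier A" using V_closed[OF per] by auto
  fix \<nu> assume "\<nu> \<in> P" "d \<nu> = p"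
  then show "V p p \<otimes> t \<nu> = \<one> \<otimes> t \<nu>"
    using V_t[OF per cycline_unit] by (simp add: u_unit t_comp)
qed

lemma V_mult:
  assumes "ddiff p q \<in> Per \<Lambda> G \<phi>" "ddiff q n \<in> Per \<Lambda> G \<phi>"
  shows "V p q \<otimes> V q n = V p n"
proof (rule eqI_on_paths[where q = n])
  note per = assms Per_ddiff_trans[OF assms]
  note cl = per[THEN V_closed]
  show "V p q \<otimes> V q n \<in> carrier A" "V p n \<in> carrier A" using cl by auto
  fix \<rho> assume \<rho>: "\<rho> \<in> P" "d \<rho> = n"
  obtain \<nu> k where k: "cycline \<nu> k \<rho>" "d \<nu> = q" using cycline_exists_left[OF per(2) \<rho>] .
  note e = cyclineD[OF k(1)]
  obtain \<mu> h where h: "cycline \<mu> h \<nu>" "d \<mu> = p" using cycline_exists_left[OF per(1) e(1) k(2)] .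
  note c = cyclineD[OF h(1)]
  have "V p q \<otimes> V q n \<otimes> t \<rho> = V p q \<otimes> (V q n \<otimes> t \<rho>)"
    using cl e by (simp add: m_assoc)
  also have "\<dots> = (V p q \<otimes> t \<nu>) \<otimes> u k"
    using V_t[OF per(2) k \<rho>(2)] cl e by (simp add: m_assoc)
  also have "\<dots> = t \<mu> \<otimes> u (h \<star> k)"
    using V_t[OF per(1) h k(2)] c e by (simp add: m_assoc u_mult)
  also have "\<dots> = V p n \<otimes> t \<rho>"
    using V_t[OF per(3) cycline_mult[OF h(1) k(1)] h(2) \<rho>(2)] by simp
  finally show "V p q \<otimes> V q n \<otimes> t \<rho> = V p n \<otimes> t \<rho>" .
qed

text \<open>The map \<theta> for (p, q) is a bijection with inverse the one for (q, p), and the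
  arrows are mutually inverse. So the adjoint of the summand at \<mu> is the summand of
  \<open>V q p\<close> at \<theta>(\<mu>), and the sum is reindexed.\<close>

lemma adj_V:
  assumes per: "ddiff p q \<in> Per \<Lambda> G \<phi>"
  shows "adj A (V p q) = V q p"
proof -
  let ?\<theta> = "theta \<Lambda> G \<phi> p q" and ?h = "hper \<Lambda> G \<phi> p q"
  let ?f = "\<lambda>\<nu>. t \<nu> \<otimes> u (hper \<Lambda> G \<phi> q p \<nu>) \<otimes> adj A (t (theta \<Lambda> G \<phi> q p \<nu>))"
  note per' = Per_ddiff_swap[OF per]
  have inv: "theta \<Lambda> G \<phi> q p (?\<theta> \<mu>) = \<mu>" "hper \<Lambda> G \<phi> q p (?\<theta> \<mu>) = iv (?h \<mu>)"
    and mem: "?\<theta> \<mu> \<in> paths_deg \<Lambda> q" if "\<mu> \<in> paths_deg \<Lambda> p" for \<mu>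
    using theta_hper_eq[OF cycline_inv[OF cycline_theta(1)[OF per that]]] cycline_theta[OF per that]
      cyclineD(2)[OF cycline_theta(1)[OF per that]] that
    by (auto simp: in_paths_deg)
  have "?\<theta> ` paths_deg \<Lambda> p = paths_deg \<Lambda> q"
  proof
    show "paths_deg \<Lambda> q \<subseteq> ?\<theta> ` paths_deg \<Lambda> p"
    proof
      fix \<nu> assume "\<nu> \<in> paths_deg \<Lambda> q"
      then have \<nu>: "\<nu> \<in> P" "d \<nu> = q" by (simp_all add: in_paths_deg)
      obtain \<mu> h where "cycline \<mu> h \<nu>" "d \<mu> = p" using cycline_exists_left[OF per \<nu>] .
      then show "\<nu> \<in> ?\<theta> ` paths_deg \<Lambda> p"
        using theta_hper_eq(1) cyclineD(1) \<nu>(2) by (metis in_paths_deg imageI)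
    qed
  qed (use mem in auto)
  moreover have "inj_on ?\<theta> (paths_deg \<Lambda> p)" using inv(1) by (rule inj_on_inverseI)
  ultimately have "V q p = (\<Oplus>\<mu>\<in>paths_deg \<Lambda> p. ?f (?\<theta> \<mu>))"
    using add.finprod_reindex[of ?f ?\<theta> "paths_deg \<Lambda> p"] V_summand_closed[OF per'] by (simp add: V_def)
  also have "\<dots> = (\<Oplus>\<mu>\<in>paths_deg \<Lambda> p. adj A (t \<mu> \<otimes> u (?h \<mu>) \<otimes> adj A (t (?\<theta> \<mu>))))"
  proof (rule finsum_cong'[OF refl])
    fix \<mu> assume \<mu>: "\<mu> \<in> paths_deg \<Lambda> p"
    note c = cyclineD[OF cycline_theta(1)[OF per \<mu>]]
    show "?f (?\<theta> \<mu>) = adj A (t \<mu> \<otimes> u (?h \<mu>) \<otimes> adj A (t (?\<theta> \<mu>)))"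
      using c by (simp add: inv[OF \<mu>] adj_mult adj_adj adj_u m_assoc)
  qed (use V_summand_closed[OF per] in \<open>auto simp: Pi_def adj_closed\<close>)
  also have "\<dots> = adj A (V p q)"
    unfolding V_def by (rule adj_finsum[OF finite_paths_deg V_summand_closed[OF per], symmetric])
  finally show ?thesis by simp
qed

lemma V_u:
  assumes per: "ddiff p q \<in> Per \<Lambda> G \<phi>" and g: "g \<in> arrs"
  shows "V p q \<otimes> u g = u g \<otimes> V p q"
proof (rule eqI_on_paths[where q = q])
  note cl = V_closed[OF per] u_closed[OF g]
  show "V p q \<otimes> u g \<in> carrier A" "u g \<otimes> V p q \<in> carrier A" using cl by auto
  fix \<nu> assume \<nu>: "\<nu> \<in> P" "d \<nu> = q"
  obtain \<mu> h where h: "cycline \<mu> h \<nu>" "d \<mu> = p" using cycline_exists_left[OF per \<nu>] .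
  note c = cyclineD[OF h(1)] and rng = cycline_rng[OF h(1)]
  have right: "u g \<otimes> V p q \<otimes> t \<nu> = (u g \<otimes> t \<mu>) \<otimes> u h"
    using cl c V_t[OF per h \<nu>(2)] by (simp add: m_assoc)
  have left: "V p q \<otimes> u g \<otimes> t \<nu> = V p q \<otimes> (u g \<otimes> t \<nu>)"
    using cl c by (simp add: m_assoc)
  show "V p q \<otimes> u g \<otimes> t \<nu> = u g \<otimes> V p q \<otimes> t \<nu>"
  proof (cases "dm g = r \<nu>")
    case True
    let ?a = "rs g \<mu>" and ?b = "rs g \<nu>"
    have a: "?a \<in> arrs" "dm ?a = cd h" and b: "?b \<in> arrs" "dm ?b = dm h" "cd ?b = s (g \<rhd> \<nu>)"
      using True rng c g by simp_all
    have cyc: "cycline (g \<rhd> \<mu>) (?a \<star> h \<star> iv ?b) (g \<rhd> \<nu>)"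
      using cycline_act[OF h(1) g] True rng by simp
    have "V p q \<otimes> u g \<otimes> t \<nu> = (V p q \<otimes> t (g \<rhd> \<nu>)) \<otimes> u ?b"
      unfolding left using u_t[OF g \<nu>(1)] True cl b g \<nu> by (simp add: m_assoc)
    also have "\<dots> = t (g \<rhd> \<mu>) \<otimes> (u (?a \<star> h \<star> iv ?b) \<otimes> u ?b)"
      using V_t[OF per cyc] cyclineD(1,3)[OF cyc] True g rng c h \<nu> b by (simp add: m_assoc)
    \<comment> \<open>The factor (g|_\<nu>)^-1 contributed by \<open>cycline_act\<close> cancels the
      restriction that appears when \<open>u g\<close> moves past \<open>t \<nu>\<close>.\<close>
    also have "u (?a \<star> h \<star> iv ?b) \<otimes> u ?b = u ?a \<otimes> u h"
    proof -
      have "?a \<star> h \<star> iv ?b \<star> ?b = ?a \<star> h"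
        using a b c(3) gmult_assoc[of "?a \<star> h" "iv ?b" ?b] arrow_simps(3)[of "?a \<star> h"] by simp
      then show ?thesis using a b c(3) by (simp add: u_mult)
    qed
    also have "t (g \<rhd> \<mu>) \<otimes> (u ?a \<otimes> u h) = u g \<otimes> V p q \<otimes> t \<nu>"
      unfolding right using u_t[OF g c(1)] True rng g c a by (simp add: m_assoc)
    finally show ?thesis .
  next
    \<comment> \<open>Both sides vanish, because \<mu> and \<nu> have the same range.\<close>
    case False
    then show ?thesis unfolding left right using u_t[OF g] \<nu> c rng cl by simp
  qed
qed

text \<open>For \<nu> of degree q the path \<kappa>\<nu> has degree q + d \<kappa>, so
  \<open>V p q\<close> is first replaced by its shift by d \<kappa>; prepending \<kappa> to the
  triple of \<nu> then gives the value.\<close>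

lemma V_commutes_t:
  assumes per: "ddiff p q \<in> Per \<Lambda> G \<phi>" and \<kappa>: "\<kappa> \<in> P"
  shows "V p q \<otimes> t \<kappa> = t \<kappa> \<otimes> V p q"
proof (rule eqI_on_paths[where q = q])
  note cl = V_closed[OF per] t_closed[OF \<kappa>]
  show "V p q \<otimes> t \<kappa> \<in> carrier A" "t \<kappa> \<otimes> V p q \<in> carrier A" using cl by auto
  fix \<nu> assume \<nu>: "\<nu> \<in> P" "d \<nu> = q"
  obtain \<mu> h where h: "cycline \<mu> h \<nu>" "d \<mu> = p" using cycline_exists_left[OF per \<nu>] .
  note c = cyclineD[OF h(1)] and rng = cycline_rng[OF h(1)]
  have right: "t \<kappa> \<otimes> V p q \<otimes> t \<nu> = (t \<kappa> \<otimes> t \<mu>) \<otimes> u h"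
    using cl c V_t[OF per h \<nu>(2)] by (simp add: m_assoc)
  have left: "V p q \<otimes> t \<kappa> \<otimes> t \<nu> = V p q \<otimes> (t \<kappa> \<otimes> t \<nu>)"
    using cl c by (simp add: m_assoc)
  show "V p q \<otimes> t \<kappa> \<otimes> t \<nu> = t \<kappa> \<otimes> V p q \<otimes> t \<nu>"
  proof (cases "s \<kappa> = r \<nu>")
    case True
    have cyc: "cycline (\<kappa> \<bullet> \<mu>) h (\<kappa> \<bullet> \<nu>)" using cycline_prepend[OF h(1) \<kappa>] True rng by simp
    have "V p q \<otimes> (t \<kappa> \<otimes> t \<nu>) = V (p + d \<kappa>) (q + d \<kappa>) \<otimes> t (\<kappa> \<bullet> \<nu>)"
      using V_shift[OF per] t_comp[OF \<kappa> \<nu>(1) True] by simp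
    also have "\<dots> = t (\<kappa> \<bullet> \<mu>) \<otimes> u h"
      using V_t[OF _ cyc] per \<kappa> True rng c h \<nu> by (simp add: ddiff_shift add.commute)
    finally show ?thesis unfolding left right using \<kappa> c True rng by (simp add: t_comp)
  next
    case False
    then show ?thesis unfolding left right using t_mult_zero \<kappa> \<nu> c rng cl by simp
  qed
qed

lemma V_unitary:
  assumes "ddiff p q \<in> Per \<Lambda> G \<phi>"
  shows "adj A (V p q) \<otimes> V p q = \<one>" "V p q \<otimes> adj A (V p q) = \<one>"
  using V_mult[OF assms Per_ddiff_swap[OF assms]] V_mult[OF Per_ddiff_swap[OF assms] assms]
  by (simp_all add: adj_V[OF assms] V_self)

text \<open>The centraliser of V is a C*-subalgebra containing the generators, hence
  everything.\<close>

lemma V_central: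
  assumes gen: "generates (u ` arrs \<union> t ` P) A" and per: "ddiff p q \<in> Per \<Lambda> G \<phi>"
  shows "V p q \<in> carrier (central_unitaries A)"
proof -
  note cl = V_closed[OF per]
  have "u ` arrs \<union> t ` P \<subseteq> {x \<in> carrier A. V p q \<otimes> x = x \<otimes> V p q}"
    using V_u[OF per] V_commutes_t[OF per] by auto
  then have "{x \<in> carrier A. V p q \<otimes> x = x \<otimes> V p q} = carrier A"
    using gen centralizer_subalgebra[OF cl V_unitary[OF per]] unfolding generates_def by blast
  then show ?thesis
    using cl V_unitary[OF per] by (auto simp: central_unitaries_def centre_def)
qed

lemma central_representation:
  assumes gen: "generates (u ` arrs \<union> t ` P) A"
  obtains W where "group_hom (Per_group \<Lambda> G \<phi>) (central_unitaries A) W"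
    and "\<And>p q. ddiff p q \<in> Per \<Lambda> G \<phi> \<Longrightarrow> W (ddiff p q) = V p q"
proof -
  have "\<exists>W. \<forall>p q. ddiff p q \<in> Per \<Lambda> G \<phi> \<longrightarrow> W (ddiff p q) = V p q"
  proof -
    \<comment> \<open>For each period a one value fits all pairs with difference a, by
      \<open>V_cong\<close>; choosing these values turns V into a function of the
      difference.\<close>
    have "\<exists>x. \<forall>p q. a = ddiff p q \<and> a \<in> Per \<Lambda> G \<phi> \<longrightarrow> x = V p q" for a
      using V_cong by metis
    then show ?thesis by metis
  qed
  then obtain W where W: "\<And>p q. ddiff p q \<in> Per \<Lambda> G \<phi> \<Longrightarrow> W (ddiff p q) = V p q" by blast
  have "W \<in> hom (Per_group \<Lambda> G \<phi>) (central_unitaries A)"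
  proof (rule homI)
    fix a assume "a \<in> carrier (Per_group \<Lambda> G \<phi>)"
    then have a: "a \<in> Per \<Lambda> G \<phi>" by (simp add: Per_group_def)
    obtain p q where "a = ddiff p q" using Per_obtain[OF a] .
    then show "W a \<in> carrier (central_unitaries A)" using W V_central[OF gen] a by simp
  next
    fix a b assume "a \<in> carrier (Per_group \<Lambda> G \<phi>)" "b \<in> carrier (Per_group \<Lambda> G \<phi>)"
    then have ab: "a \<in> Per \<Lambda> G \<phi>" "b \<in> Per \<Lambda> G \<phi>" by (simp_all add: Per_group_def)
    \<comment> \<open>A common middle degree brings the product into the form required by
      \<open>V_mult\<close>.\<close>
    obtain p q n where pqn: "a = ddiff p q" "b = ddiff q n" using Per_obtain2[OF ab] .
    have per: "ddiff p q \<in> Per \<Lambda> G \<phi>" "ddiff q n \<in> Per \<Lambda> G \<phi>" using ab pqn by simp_all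
    have "W (a + b) = W a \<otimes> W b"
      unfolding pqn ddiff_add W[OF per(1)] W[OF per(2)] W[OF Per_ddiff_trans[OF per]]
      by (rule V_mult[OF per, symmetric])
    then show "W (a \<otimes>\<^bsub>Per_group \<Lambda> G \<phi>\<^esub> b) = W a \<otimes>\<^bsub>central_unitaries A\<^esub> W b"
      by (simp add: Per_group_def central_unitaries_def)
  qed
  then have "group_hom (Per_group \<Lambda> G \<phi>) (central_unitaries A) W"
    by (simp add: group_hom_def group_hom_axioms_def group_Per group_central_unitaries)
  then show ?thesis using that W by blast
qed

end

theorem proposition10p1:
  fixes \<Lambda> :: "('k::finite, 'l) kgraph"
    and G :: "('l, 'g) groupoid"
    and \<phi> :: "'g \<Rightarrow> 'l piso"
    and A :: "'a cstar"
    and u :: "'g \<Rightarrow> 'a"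
    and t :: "'l \<Rightarrow> 'a"
  assumes "k_graph \<Lambda>"
    and "\<And>i. paths_deg \<Lambda> (std_gen i) \<noteq> {}"
    and "finite_kgraph \<Lambda>"
    and "strongly_connected \<Lambda>"
    and "self_similar_action \<Lambda> G \<phi>"
    and "cuntz_pimsner_algebra \<Lambda> G \<phi> A u t"
  shows "\<exists>V. group_hom (Per_group \<Lambda> G \<phi>) (central_unitaries A) V \<and>
    (\<forall>p q. ddiff p q \<in> Per \<Lambda> G \<phi> \<longrightarrow>
       V (ddiff p q) =
         (\<Oplus>\<^bsub>A\<^esub>\<mu>\<in>paths_deg \<Lambda> p.
            t \<mu> \<otimes>\<^bsub>A\<^esub> u (hper \<Lambda> G \<phi> p q \<mu>) \<otimes>\<^bsub>A\<^esub> adj A (t (theta \<Lambda> G \<phi> p q \<mu>))))"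
proof -
  have A: "cstar_algebra A" "CP_family \<Lambda> G \<phi> A u t" "generates (u ` arrows G \<union> t ` paths \<Lambda>) A"
    using assms(6) by (simp_all add: cuntz_pimsner_algebra_def)
  interpret cstar_algebra A by (rule A(1))
  interpret cuntz_pimsner_rep \<Lambda> G \<phi> A u t
    using assms A(2) by unfold_locales
  obtain W where "group_hom (Per_group \<Lambda> G \<phi>) (central_unitaries A) W"
    "\<And>p q. ddiff p q \<in> Per \<Lambda> G \<phi> \<Longrightarrow> W (ddiff p q) = V p q"
    using central_representation[OF A(3)] by blast
  then show ?thesis by (auto simp: V_def)
qed

end
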